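(* Both the steerable weight $\mathscr{S}_{\mathrm W}$ and the robustness of steering $\mathscr{S}_{\mathrm{Rob}}$ are convex steering monotones.
   Context: Notation: $[n]=\{0,\dots,n-1\}$. All index sets are finite and all Hilbert spaces finite-dimensional. Assemblages. Fix natural numbers $d,r,s\ge1$ and $\mathcal{H}_B=\mathbb{C}^d$. A (no-signaling) assemblage with parameters $(d,r,s)$ is a family $\rho_{A|X}=\{\varrho_{A|X}(a,x)\}_{a\in[r],x\in[s]}$ of positive semidefinite operators on $\mathcal{H}_B$ such that $\varrho_B:=\sum_a\varrho_{A|X}(a,x)$ does not depend on $x$. Its trace is $\mathrm{Tr}[\rho_{A|X}]:=\mathrm{Tr}[\varrho_B]$; it is normalised if this equals $1$. Scalar multiples and sums are taken componentwise. Unsteerable assemblages. A normalised assemblage $\{\varsigma_{A|X}(a,x)\}$ is unsteerable (belongs to $\mathsf{LHS}$) if there exist a probability distribution $P_\Lambda$ on a finite set, conditional probability distributions $P_{A|X\Lambda}$, and density operators $\xi(\lambda)$ on $\mathcal{H}_B$ with $\varsigma_{A|X}(a,x)=\sum_\lambda P_\Lambda(\lambda)P_{A|X\Lambda}(a,x,\lambda)\,\xi(\lambda)$ for all $a,x$. Steerable weight. For a normalised assemblage $\rho_{A|X}$, $\mathscr{S}_{\mathrm W}(\rho_{A|X})$ is the minimum $\nu\in\mathbb{R}_{\ge0}$ such that $\rho_{A|X}=\nu\,\tilde\rho_{A|X}+(1-\nu)\,\sigma_{A|X}$ for some normalised (no-signaling, otherwise arbitrary) assemblage $\tilde\rho_{A|X}$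 and some $\sigma_{A|X}\in\mathsf{LHS}$, all with the same parameters. Robustness of steering. For a normalised assemblage $\rho_{A|X}$, $\mathscr{S}_{\mathrm{Rob}}(\rho_{A|X})$ is the minimum $\nu\in\mathbb{R}_{\ge0}$ such that, for some normalised (no-signaling, otherwise arbitrary) assemblage $\tilde\rho_{A|X}$ with the same parameters, $\frac{1}{1+\nu}\rho_{A|X}+\frac{\nu}{1+\nu}\tilde\rho_{A|X}\in\mathsf{LHS}$. 1W-LOCCs. A deterministic 1W-LOCC $\mathcal{M}$ from assemblages with parameters $(d,r,s)$ to assemblages with parameters $(d_f,r_f,s_f)$ is specified by a finite set of $\omega$'s, operators $K_\omega:\mathbb{C}^d\to\mathbb{C}^{d_f}$ with $\sum_\omega K_\omega^\dagger K_\omega=\mathbb{1}$, and normalised conditional probability distributions $P(x|x_f,\omega)$ and $P(a_f|a,x,\omega,x_f)$ ($x\in[s]$, $x_f\in[s_f]$, $a\in[r]$, $a_f\in[r_f]$). It is $\mathcal{M}=\sum_\omega\mathcal{M}_\omega$, with $$[\mathcal{M}_\omega(\rho_{A|X})](a_f,x_f)=\sum_{a,x}P(x|x_f,\omega)P(a_f|a,x,\omega,x_f)\,K_\omega\,\varrho_{A|X}(a,x)\,K_\omega^\dagger .$$ Convex steering monotones. A function $\mathscr{S}$ from normalised assemblages (of all parameters) to $\mathbb{R}_{\ge0}$ is a steering monotone if (i) $\mathscr{S}(\rho_{A|X})=0$ for all $\rho_{A|X}\in\mathsf{LHS}$; and (ii) for every deterministic 1W-LOCC $\mathcal{M}=\sum_\omega\mathcal{M}_\omega$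 and every normalised assemblage $\rho_{A|X}$ in its domain, with $P_\Omega(\omega)=\mathrm{Tr}[\mathcal{M}_\omega(\rho_{A|X})]$, $$\sum_\omega P_\Omega(\omega)\,\mathscr{S}\!\left(\frac{\mathcal{M}_\omega(\rho_{A|X})}{\mathrm{Tr}[\mathcal{M}_\omega(\rho_{A|X})]}\right)\le\mathscr{S}(\rho_{A|X})$$ (terms with $P_\Omega(\omega)=0$ are omitted). It is a convex steering monotone if in addition (iii) $\mathscr{S}(\mu\rho_{A|X}+(1-\mu)\rho'_{A|X})\le\mu\mathscr{S}(\rho_{A|X})+(1-\mu)\mathscr{S}(\rho'_{A|X})$ for all $0\le\mu\le1$ and all normalised assemblages $\rho_{A|X},\rho'_{A|X}$ with the same parameters. *)

theory Defs
  imports "HOL-Library.FuncSet" "Jordan_Normal_Form.Schur_Decomposition"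
begin

section \<open>Operators\<close>

definition mat_trace :: "complex mat \<Rightarrow> complex" where
  "mat_trace A = (\<Sum>i<dim_row A. A $$ (i, i))"

(* The type of matrices is not a comm_monoid_add (there is a zero for every shape),
   so finite sums of m x n matrices are formed entrywise. *)
definition msum :: "nat \<Rightarrow> nat \<Rightarrow> ('i \<Rightarrow> complex mat) \<Rightarrow> 'i set \<Rightarrow> complex mat" where
  "msum m n f I = mat m n (\<lambda>(j, k). \<Sum>i\<in>I. f i $$ (j, k))"

(* The order on complex numbers is that of Complex_Order: 0 \<le> z means that z is real and
   nonnegative.  Hence Hermiticity is implied. *)
definition psd :: "nat \<Rightarrow> complex mat \<Rightarrow> bool" where
  "psd d A \<longleftrightarrow> A \<in> carrier_mat d d \<and> (\<forall>v\<in>carrier_vec d. 0 \<le> (A *\<^sub>v v) \<bullet>c v)"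

definition density :: "nat \<Rightarrow> complex mat \<Rightarrow> bool" where
  "density d A \<longleftrightarrow> psd d A \<and> mat_trace A = 1"

definition prob_dist :: "'i set \<Rightarrow> ('i \<Rightarrow> real) \<Rightarrow> bool" where
  "prob_dist I p \<longleftrightarrow> finite I \<and> (\<forall>i\<in>I. 0 \<le> p i) \<and> (\<Sum>i\<in>I. p i) = 1"

section \<open>Assemblages\<close>

(* A family indexed by (a, x), with a < r and x < s.  Families are extensional, i.e. undefined
   outside the index set, so that families with equal entries are equal. *)
type_synonym family = "nat \<times> nat \<Rightarrow> complex mat"

definition reduced :: "nat \<Rightarrow> nat \<Rightarrow> family \<Rightarrow> nat \<Rightarrow> complex mat" where
  "reduced d r \<rho> x = msum d d (\<lambda>a. \<rho> (a, x)) {..<r}"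

definition assemblage :: "nat \<Rightarrow> nat \<Rightarrow> nat \<Rightarrow> family \<Rightarrow> bool" where
  "assemblage d r s \<rho> \<longleftrightarrow>
     1 \<le> d \<and> 1 \<le> r \<and> 1 \<le> s \<and>
     \<rho> \<in> extensional ({..<r} \<times> {..<s}) \<and>
     (\<forall>a<r. \<forall>x<s. psd d (\<rho> (a, x))) \<and>
     (\<forall>x<s. \<forall>y<s. reduced d r \<rho> x = reduced d r \<rho> y)"

(* By no-signaling the choice of the input 0 is immaterial. *)
definition asm_trace :: "nat \<Rightarrow> nat \<Rightarrow> family \<Rightarrow> complex" where
  "asm_trace d r \<rho> = mat_trace (reduced d r \<rho> 0)"

definition normalised :: "nat \<Rightarrow> nat \<Rightarrow> nat \<Rightarrow> family \<Rightarrow> bool" where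
  "normalised d r s \<rho> \<longleftrightarrow> assemblage d r s \<rho> \<and> asm_trace d r \<rho> = 1"

definition asm_scale :: "nat \<Rightarrow> nat \<Rightarrow> real \<Rightarrow> family \<Rightarrow> family" where
  "asm_scale r s c \<rho> = restrict (\<lambda>p. complex_of_real c \<cdot>\<^sub>m \<rho> p) ({..<r} \<times> {..<s})"

definition asm_add :: "nat \<Rightarrow> nat \<Rightarrow> family \<Rightarrow> family \<Rightarrow> family" where
  "asm_add r s \<rho> \<sigma> = restrict (\<lambda>p. \<rho> p + \<sigma> p) ({..<r} \<times> {..<s})"

(* The arguments of PA are a, x and the hidden variable, in this order. *)
definition LHS :: "nat \<Rightarrow> nat \<Rightarrow> nat \<Rightarrow> family \<Rightarrow> bool" where
  "LHS d r s \<sigma> \<longleftrightarrow> normalised d r s \<sigma> \<and>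
     (\<exists>(\<Lambda> :: nat set) P PA \<xi>.
        prob_dist \<Lambda> P \<and>
        (\<forall>x<s. \<forall>l\<in>\<Lambda>. prob_dist {..<r} (\<lambda>a. PA a x l)) \<and>
        (\<forall>l\<in>\<Lambda>. density d (\<xi> l)) \<and>
        (\<forall>a<r. \<forall>x<s. \<sigma> (a, x) = msum d d (\<lambda>l. complex_of_real (P l * PA a x l) \<cdot>\<^sub>m \<xi> l) \<Lambda>))"

section \<open>Steerable weight and robustness of steering\<close>

(* Both quantities are genuine minima: on the reals, LEAST denotes the minimum and is
   unspecified where the infimum is not attained. *)
definition steerable_weight :: "nat \<Rightarrow> nat \<Rightarrow> nat \<Rightarrow> family \<Rightarrow> real" where
  "steerable_weight d r s \<rho> =
     (LEAST \<nu>. 0 \<le> \<nu> \<and>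
        (\<exists>\<rho>' \<sigma>. normalised d r s \<rho>' \<and> LHS d r s \<sigma> \<and>
           \<rho> = asm_add r s (asm_scale r s \<nu> \<rho>') (asm_scale r s (1 - \<nu>) \<sigma>)))"

definition steering_robustness :: "nat \<Rightarrow> nat \<Rightarrow> nat \<Rightarrow> family \<Rightarrow> real" where
  "steering_robustness d r s \<rho> =
     (LEAST \<nu>. 0 \<le> \<nu> \<and>
        (\<exists>\<rho>'. normalised d r s \<rho>' \<and>
           LHS d r s (asm_add r s (asm_scale r s (1 / (1 + \<nu>)) \<rho>) (asm_scale r s (\<nu> / (1 + \<nu>)) \<rho>'))))"

section \<open>One-way LOCCs\<close>

(* Arguments: input_prob x x_f \<omega> for P(x | x_f, \<omega>), and
   output_prob a_f a x \<omega> x_f for P(a_f | a, x, \<omega>, x_f). *)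
record locc =
  outcomes :: "nat set"
  kraus :: "nat \<Rightarrow> complex mat"
  input_prob :: "nat \<Rightarrow> nat \<Rightarrow> nat \<Rightarrow> real"
  output_prob :: "nat \<Rightarrow> nat \<Rightarrow> nat \<Rightarrow> nat \<Rightarrow> nat \<Rightarrow> real"

definition locc_1W ::
  "nat \<Rightarrow> nat \<Rightarrow> nat \<Rightarrow> nat \<Rightarrow> nat \<Rightarrow> nat \<Rightarrow> locc \<Rightarrow> bool" where
  "locc_1W d r s df rf sf M \<longleftrightarrow>
     1 \<le> d \<and> 1 \<le> r \<and> 1 \<le> s \<and> 1 \<le> df \<and> 1 \<le> rf \<and> 1 \<le> sf \<and>
     finite (outcomes M) \<and>
     (\<forall>\<omega>\<in>outcomes M. kraus M \<omega> \<in> carrier_mat df d) \<and>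
     msum d d (\<lambda>\<omega>. mat_adjoint (kraus M \<omega>) * kraus M \<omega>) (outcomes M) = 1\<^sub>m d \<and>
     (\<forall>\<omega>\<in>outcomes M. \<forall>xf<sf. prob_dist {..<s} (\<lambda>x. input_prob M x xf \<omega>)) \<and>
     (\<forall>\<omega>\<in>outcomes M. \<forall>xf<sf. \<forall>a<r. \<forall>x<s.
        prob_dist {..<rf} (\<lambda>af. output_prob M af a x \<omega> xf))"

definition locc_branch ::
  "nat \<Rightarrow> nat \<Rightarrow> nat \<Rightarrow> nat \<Rightarrow> nat \<Rightarrow> locc \<Rightarrow> nat \<Rightarrow> family \<Rightarrow> family" where
  "locc_branch r s df rf sf M \<omega> \<rho> =
     restrict (\<lambda>(af, xf).
         msum df df (\<lambda>(a, x).
             complex_of_real (input_prob M x xf \<omega> * output_prob M af a x \<omega> xf) \<cdot>\<^sub>m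
               (kraus M \<omega> * \<rho> (a, x) * mat_adjoint (kraus M \<omega>)))
           ({..<r} \<times> {..<s}))
       ({..<rf} \<times> {..<sf})"

definition branch_prob ::
  "nat \<Rightarrow> nat \<Rightarrow> nat \<Rightarrow> nat \<Rightarrow> nat \<Rightarrow> locc \<Rightarrow> family \<Rightarrow> nat \<Rightarrow> real" where
  "branch_prob r s df rf sf M \<rho> \<omega> = Re (asm_trace df rf (locc_branch r s df rf sf M \<omega> \<rho>))"

section \<open>Convex steering monotones\<close>

(* A real-valued function of assemblages of all parameters: S d r s \<rho>. *)
type_synonym functional = "nat \<Rightarrow> nat \<Rightarrow> nat \<Rightarrow> family \<Rightarrow> real"

definition steering_monotone :: "functional \<Rightarrow> bool" where
  "steering_monotone S \<longleftrightarrow>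
     (\<forall>d r s \<rho>. normalised d r s \<rho> \<longrightarrow> 0 \<le> S d r s \<rho>) \<and>
     (\<forall>d r s \<rho>. LHS d r s \<rho> \<longrightarrow> S d r s \<rho> = 0) \<and>
     (\<forall>d r s df rf sf M \<rho>.
        locc_1W d r s df rf sf M \<longrightarrow> normalised d r s \<rho> \<longrightarrow>
        (\<Sum>\<omega> | \<omega> \<in> outcomes M \<and> branch_prob r s df rf sf M \<rho> \<omega> \<noteq> 0.
            branch_prob r s df rf sf M \<rho> \<omega> *
            S df rf sf (asm_scale rf sf (1 / branch_prob r s df rf sf M \<rho> \<omega>)
                          (locc_branch r s df rf sf M \<omega> \<rho>)))
        \<le> S d r s \<rho>)"

definition convex_steering_monotone :: "functional \<Rightarrow> bool" where
  "convex_steering_monotone S \<longleftrightarrow> steering_monotone S \<and>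
     (\<forall>d r s \<rho> \<rho>' \<mu>. normalised d r s \<rho> \<longrightarrow> normalised d r s \<rho>' \<longrightarrow> 0 \<le> \<mu> \<longrightarrow> \<mu> \<le> 1 \<longrightarrow>
        S d r s (asm_add r s (asm_scale r s \<mu> \<rho>) (asm_scale r s (1 - \<mu>) \<rho>'))
        \<le> \<mu> * S d r s \<rho> + (1 - \<mu>) * S d r s \<rho>')"

end

(*
  Up to normalisation, a decomposition for the steerable weight of \<rho> is an unsteerable \<tau> \<le> \<rho>,
  and one for the robustness is an unsteerable \<tau> \<ge> \<rho>; the weight is the least trace of \<rho> - \<tau>,
  the robustness the least trace of \<tau> - \<rho>. An unsteerable family is given by one positive
  operator for each of the finitely many deterministic strategies, and these operators are bounded by
  their trace, so the least trace is attained by compactness. The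
  decompositions can be rescaled and added, which gives convexity, and each branch of a 1W-LOCC maps a
  decomposition of \<rho> to one of the branch, where completeness of the Kraus operators preserves the
  sum of the traces, which gives monotonicity.
*)
theory Submission
  imports "HOL-Analysis.Function_Topology" "HOL-Analysis.Topology_Euclidean_Space" Defs
begin

text \<open>On the reals \<open>LEAST\<close> says nothing unless the minimum is attained, so
  nothing about the two functionals is accessible before its existence. The obstacle is the hidden
  variable in \<open>LHS\<close>: it ranges over arbitrarily large finite sets, so the models do not
  live in one fixed space. Deterministic strategies supply a fixed index set. For the robustness a
  bound is missing as well, since an unsteerable \<tau> \<ge> \<rho> may be arbitrarily large; it is
  obtained by discarding all values above one that is known to be feasible. Dropping the
  normalisation turns the coefficients 1 - \<nu> and 1 / (1 + \<nu>) into membership in a cone and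
  an objective that is affine in \<tau>. Division, and with it the degenerate case of trace 0,
  returns only where normalised objects are required.\<close>

section \<open>Quadratic forms of operators\<close>

text \<open>Vectors are plain functions of which only the first \<open>d\<close> values matter, so
  they carry no dimension conditions, and statements about operators become rearrangements of finite
  sums. Dominance between operators is later expressed as a comparison of these forms, without a
  difference of matrices.\<close>

definition qform :: "nat \<Rightarrow> complex mat \<Rightarrow> (nat \<Rightarrow> complex) \<Rightarrow> complex" where
  "qform d A v = (\<Sum>i<d. \<Sum>j<d. cnj (v i) * A $$ (i, j) * v j)"

lemma msum_carrier [simp]: "msum m n f I \<in> carrier_mat m n"
  and msum_dim [simp]: "dim_row (msum m n f I) = m" "dim_col (msum m n f I) = n"
  by (auto simp: msum_def)

lemma msum_index [simp]:
  "i < m \<Longrightarrow> j < n \<Longrightarrow> msum m n f I $$ (i, j) = (\<Sum>k\<in>I. f k $$ (i, j))"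
  by (simp add: msum_def)

lemma mat_adjoint_dim [simp]:
  "dim_row (mat_adjoint K) = dim_col K" "dim_col (mat_adjoint K) = dim_row K"
  by (auto simp: mat_adjoint_def)

lemma mat_adjoint_index [simp]:
  "i < dim_col K \<Longrightarrow> j < dim_row K \<Longrightarrow> mat_adjoint K $$ (i, j) = cnj (K $$ (j, i))"
  for K :: "complex mat"
  by (simp add: mat_adjoint_def mat_of_rows_index conjugate_complex_def)

lemma psd_iff_qform: "psd d A \<longleftrightarrow> A \<in> carrier_mat d d \<and> (\<forall>v. 0 \<le> qform d A v)"
proof -
  have inner: "(A *\<^sub>v w) \<bullet>c w = qform d A (\<lambda>i. w $ i)"
    if "A \<in> carrier_mat d d" "w \<in> carrier_vec d" for w
    using that
    by (auto simp: qform_def scalar_prod_def sum_distrib_left sum_distrib_right lessThan_atLeast0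
        mult_ac intro!: sum.cong)
  have "qform d A v = qform d A (\<lambda>i. vec d v $ i)" for v
    by (simp add: qform_def)
  then have "(\<forall>v. 0 \<le> qform d A v) \<longleftrightarrow> (\<forall>w\<in>carrier_vec d. 0 \<le> qform d A (\<lambda>i. w $ i))"
    by (metis vec_carrier)
  then show ?thesis
    by (auto simp: psd_def inner)
qed

section \<open>Positivity under scaling, sums and conjugation\<close>

lemma qform_smult:
  "A \<in> carrier_mat d d \<Longrightarrow> qform d (c \<cdot>\<^sub>m A) v = c * qform d A v"
  by (simp add: qform_def sum_distrib_left mult_ac)

lemma qform_add:
  "A \<in> carrier_mat d d \<Longrightarrow> B \<in> carrier_mat d d \<Longrightarrow> qform d (A + B) v = qform d A v + qform d B v"
  by (simp add: qform_def algebra_simps sum.distrib)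

lemma qform_msum: "qform d (msum d d f I) v = (\<Sum>k\<in>I. qform d (f k) v)"
proof -
  have "qform d (msum d d f I) v = (\<Sum>i<d. \<Sum>j<d. \<Sum>k\<in>I. cnj (v i) * f k $$ (i, j) * v j)"
    by (simp add: qform_def sum_distrib_left sum_distrib_right mult_ac)
  also have "\<dots> = (\<Sum>i<d. \<Sum>k\<in>I. \<Sum>j<d. cnj (v i) * f k $$ (i, j) * v j)"
    by (subst sum.swap) simp
  also have "\<dots> = (\<Sum>k\<in>I. qform d (f k) v)"
    by (subst sum.swap) (simp add: qform_def)
  finally show ?thesis .
qed

lemma conjugation_index:
  assumes "K \<in> carrier_mat m d" "A \<in> carrier_mat d d" "i < m" "j < m"
  shows "(K * A * mat_adjoint K) $$ (i, j) =
    (\<Sum>k<d. \<Sum>l<d. K $$ (i, k) * A $$ (k, l) * cnj (K $$ (j, l)))"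
proof -
  have "(K * A * mat_adjoint K) $$ (i, j) =
      (\<Sum>l<d. (\<Sum>k<d. K $$ (i, k) * A $$ (k, l)) * cnj (K $$ (j, l)))"
    using assms by (simp add: scalar_prod_def lessThan_atLeast0)
  also have "\<dots> = (\<Sum>k<d. \<Sum>l<d. K $$ (i, k) * A $$ (k, l) * cnj (K $$ (j, l)))"
    by (subst sum.swap) (simp add: sum_distrib_right)
  finally show ?thesis .
qed

lemma conjugation_carrier:
  "K \<in> carrier_mat m d \<Longrightarrow> K * A * mat_adjoint K \<in> carrier_mat m m"
  by (auto intro!: carrier_matI)

text \<open>The function on the right is the adjoint of \<open>K\<close> applied to
  \<open>v\<close>. Moving \<open>K\<close> to the vectors makes positivity of the conjugated
  operator immediate.\<close>

lemma qform_conjugation: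
  assumes "K \<in> carrier_mat m d" "A \<in> carrier_mat d d"
  shows "qform m (K * A * mat_adjoint K) v = qform d A (\<lambda>k. \<Sum>i<m. cnj (K $$ (i, k)) * v i)"
proof -
  let ?t = "\<lambda>i j k l. cnj (v i) * K $$ (i, k) * A $$ (k, l) * (cnj (K $$ (j, l)) * v j)"
  have "qform m (K * A * mat_adjoint K) v = (\<Sum>i<m. \<Sum>j<m. \<Sum>k<d. \<Sum>l<d. ?t i j k l)"
    using assms
    by (simp add: qform_def conjugation_index sum_distrib_left sum_distrib_right mult_ac
        del: index_mult_mat)
  also have "\<dots> = (\<Sum>i<m. \<Sum>k<d. \<Sum>l<d. \<Sum>j<m. ?t i j k l)"
    by (subst sum.swap, subst (2) sum.swap) simp
  also have "\<dots> = (\<Sum>k<d. \<Sum>l<d. \<Sum>i<m. \<Sum>j<m. ?t i j k l)"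
    by (subst sum.swap, subst (2) sum.swap) simp
  also have "\<dots> = qform d A (\<lambda>k. \<Sum>i<m. cnj (K $$ (i, k)) * v i)"
    by (simp add: qform_def sum_distrib_left sum_distrib_right mult_ac)
  finally show ?thesis .
qed

lemma psd_carrier: "psd d A \<Longrightarrow> A \<in> carrier_mat d d"
  by (simp add: psd_def)

lemma psd_msum: "(\<And>k. k \<in> I \<Longrightarrow> psd d (f k)) \<Longrightarrow> psd d (msum d d f I)"
  by (auto simp: psd_iff_qform qform_msum intro!: sum_nonneg)

lemma psd_smult: "0 \<le> c \<Longrightarrow> psd d A \<Longrightarrow> psd d (complex_of_real c \<cdot>\<^sub>m A)"
  by (auto simp: psd_iff_qform qform_smult less_eq_complex_def intro!: mult_nonneg_nonneg)

lemma psd_add: "psd d A \<Longrightarrow> psd d B \<Longrightarrow> psd d (A + B)"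
  by (auto simp: psd_iff_qform qform_add intro!: add_nonneg_nonneg)

lemma psd_conjugation:
  "K \<in> carrier_mat m d \<Longrightarrow> psd d A \<Longrightarrow> psd m (K * A * mat_adjoint K)"
  using conjugation_carrier by (auto simp: psd_iff_qform qform_conjugation)

section \<open>Entries and trace of a positive operator\<close>

lemma qform_unit:
  assumes "i < d" shows "qform d A (\<lambda>k. if k = i then 1 else 0) = A $$ (i, i)"
proof -
  have "qform d A (\<lambda>k. if k = i then 1 else 0) =
      (\<Sum>k<d. if k = i then (\<Sum>l<d. if l = i then A $$ (k, l) else 0) else 0)"
    unfolding qform_def by (intro sum.cong refl) (simp add: if_distrib cong: if_cong)
  then show ?thesis
    using assms by simp
qed

lemma qform_two_units:
  assumes "i < d" "j < d" "i \<noteq> j"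
  shows "qform d A (\<lambda>k. if k = i then 1 else if k = j then c else 0) =
    A $$ (i, i) + A $$ (i, j) * c + cnj c * A $$ (j, i) + cnj c * A $$ (j, j) * c"
proof -
  have two: "(\<Sum>k<d. (if k = i then f k else if k = j then g k else 0)) = f i + g j"
    for f g :: "nat \<Rightarrow> complex"
  proof -
    have "(\<Sum>k<d. (if k = i then f k else if k = j then g k else 0)) =
        (\<Sum>k<d. (if k = i then f k else 0) + (if k = j then g k else 0))"
      using assms by (intro sum.cong) auto
    then show ?thesis
      using assms by (simp add: sum.distrib)
  qed
  have "qform d A (\<lambda>k. if k = i then 1 else if k = j then c else 0) =
      (\<Sum>k<d. (if k = i then (\<Sum>l<d. if l = i then A $$ (k, l) else if l = j then A $$ (k, l) * c else 0)
        else if k = j then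
          (\<Sum>l<d. if l = i then cnj c * A $$ (k, l) else if l = j then cnj c * A $$ (k, l) * c else 0)
        else 0))"
    unfolding qform_def by (intro sum.cong refl) (auto intro!: sum.cong sum.neutral)
  then show ?thesis
    by (simp add: two)
qed

lemma psd_diag_nonneg: "psd d A \<Longrightarrow> i < d \<Longrightarrow> 0 \<le> A $$ (i, i)"
  by (metis psd_iff_qform qform_unit)

lemma psd_trace_nonneg: "psd d A \<Longrightarrow> 0 \<le> mat_trace A"
  using psd_diag_nonneg[of d A] by (auto simp: mat_trace_def dest: psd_carrier intro!: sum_nonneg)

lemma psd_diag_le_trace:
  assumes "psd d A" "i < d" shows "A $$ (i, i) \<le> mat_trace A"
  using assms psd_carrier[OF assms(1)] unfolding mat_trace_def
  by (intro member_le_sum) (auto simp: psd_diag_nonneg)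

text \<open>Positivity at the vectors \<open>e\<^sub>i + c e\<^sub>j\<close> with \<open>c = 1, -1, \<i>, -\<i>\<close> bounds the real and the imaginary
  part of the entries \<open>(i, j)\<close> and \<open>(j, i)\<close>, which are conjugate to each other.\<close>

lemma psd_entry_le_trace:
  assumes psd: "psd d A" and i: "i < d" and j: "j < d"
  shows "cmod (A $$ (i, j)) \<le> 2 * Re (mat_trace A)"
proof -
  let ?t = "Re (mat_trace A)"
  have diag: "Im (A $$ (k, k)) = 0" "0 \<le> Re (A $$ (k, k))" "Re (A $$ (k, k)) \<le> ?t" if "k < d" for k
    using psd_diag_nonneg[OF psd that] psd_diag_le_trace[OF psd that]
    by (auto simp: less_eq_complex_def)
  show ?thesis
  proof (cases "i = j")
    case True
    have "cmod (A $$ (i, i)) \<le> \<bar>Re (A $$ (i, i))\<bar> + \<bar>Im (A $$ (i, i))\<bar>"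
      by (rule cmod_le)
    then show ?thesis
      using diag[OF i] True by simp
  next
    case False
    have q: "0 \<le> A $$ (i, i) + A $$ (i, j) * c + cnj c * A $$ (j, i) + cnj c * A $$ (j, j) * c" for c
      using psd qform_two_units[OF i j False, of A c] by (metis psd_iff_qform)
    have "\<bar>Re (A $$ (i, j))\<bar> \<le> ?t" "\<bar>Im (A $$ (i, j))\<bar> \<le> ?t"
      using q[of 1] q[of "-1"] q[of \<i>] q[of "-\<i>"] diag[OF i] diag[OF j]
      by (auto simp: less_eq_complex_def)
    \<comment> \<open>Estimating the modulus by the sum of the real and imaginary parts costs the
      factor 2, which is harmless because only boundedness is needed.\<close>
    then show ?thesis
      using cmod_le[of "A $$ (i, j)"] by linarith
  qed
qed

text \<open>The trace bounds all entries, off-diagonal ones included. This covers the operators and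
  assemblages that cannot be rescaled to trace 1.\<close>

lemma psd_trace_zero:
  assumes "psd d A" "mat_trace A = 0" shows "A = 0\<^sub>m d d"
proof -
  have "A $$ (i, j) = 0" if "i < d" "j < d" for i j
    using psd_entry_le_trace[OF assms(1) that] assms(2) by simp
  then show ?thesis
    using psd_carrier[OF assms(1)] by (intro eq_matI) auto
qed

lemma smult_index:
  "A \<in> carrier_mat m n \<Longrightarrow> i < m \<Longrightarrow> j < n \<Longrightarrow> (c \<cdot>\<^sub>m A) $$ (i, j) = c * A $$ (i, j)"
  by auto

lemma smult_mat_assoc: "a \<cdot>\<^sub>m (b \<cdot>\<^sub>m A) = (a * b) \<cdot>\<^sub>m A" for a b :: complex
  by (rule eq_matI) (auto simp: mult.assoc)

lemma psd_index:
  assumes "psd d A" "i < d" "j < d"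
  shows "(c \<cdot>\<^sub>m A) $$ (i, j) = c * A $$ (i, j)"
    and "psd d B \<Longrightarrow> (A + B) $$ (i, j) = A $$ (i, j) + B $$ (i, j)"
  using assms by (auto simp: psd_def)

section \<open>Operations on assemblages\<close>

lemma assemblage_iff_entries:
  "assemblage d r s \<rho> \<longleftrightarrow>
     1 \<le> d \<and> 1 \<le> r \<and> 1 \<le> s \<and> \<rho> \<in> extensional ({..<r} \<times> {..<s}) \<and>
     (\<forall>a<r. \<forall>x<s. psd d (\<rho> (a, x))) \<and>
     (\<forall>x<s. \<forall>y<s. \<forall>i<d. \<forall>j<d. (\<Sum>a<r. \<rho> (a, x) $$ (i, j)) = (\<Sum>a<r. \<rho> (a, y) $$ (i, j)))"
proof -
  have "reduced d r \<rho> x = reduced d r \<rho> y \<longleftrightarrow>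
      (\<forall>i<d. \<forall>j<d. (\<Sum>a<r. \<rho> (a, x) $$ (i, j)) = (\<Sum>a<r. \<rho> (a, y) $$ (i, j)))" for x y
    by (auto simp: reduced_def mat_eq_iff)
  then show ?thesis
    by (simp add: assemblage_def)
qed

lemma assemblage_carrier:
  "assemblage d r s \<rho> \<Longrightarrow> a < r \<Longrightarrow> x < s \<Longrightarrow> \<rho> (a, x) \<in> carrier_mat d d"
  by (simp add: assemblage_def psd_def)

lemma assemblage_no_signaling:
  assumes "assemblage d r s \<rho>" "x < s" "y < s" "i < d" "j < d"
  shows "(\<Sum>a<r. \<rho> (a, x) $$ (i, j)) = (\<Sum>a<r. \<rho> (a, y) $$ (i, j))"
  using assms unfolding assemblage_iff_entries by blast

lemma assemblage_eqI:
  assumes "assemblage d r s \<rho>" "assemblage d r s \<sigma>"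
    and "\<And>a x i j. a < r \<Longrightarrow> x < s \<Longrightarrow> i < d \<Longrightarrow> j < d \<Longrightarrow> \<rho> (a, x) $$ (i, j) = \<sigma> (a, x) $$ (i, j)"
  shows "\<rho> = \<sigma>"
proof (rule extensionalityI[of _ "{..<r} \<times> {..<s}"])
  fix p assume "p \<in> {..<r} \<times> {..<s}"
  then obtain a x where p: "p = (a, x)" "a < r" "x < s"
    by auto
  show "\<rho> p = \<sigma> p"
    using assms(3) p assemblage_carrier[OF assms(1) p(2,3)] assemblage_carrier[OF assms(2) p(2,3)]
    by (intro eq_matI) auto
qed (use assms in \<open>auto simp: assemblage_def\<close>)

lemma asm_scale_index:
  assumes "assemblage d r s \<rho>" "a < r" "x < s"
  shows "i < d \<Longrightarrow> j < d \<Longrightarrow> asm_scale r s c \<rho> (a, x) $$ (i, j) = of_real c * \<rho> (a, x) $$ (i, j)"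
    and "qform d (asm_scale r s c \<rho> (a, x)) v = of_real c * qform d (\<rho> (a, x)) v"
  using assemblage_carrier[OF assms] assms(2,3) by (auto simp: asm_scale_def qform_smult)

lemma asm_add_index:
  assumes "assemblage d r s \<rho>" "assemblage d r s \<sigma>" "a < r" "x < s"
  shows "i < d \<Longrightarrow> j < d \<Longrightarrow> asm_add r s \<rho> \<sigma> (a, x) $$ (i, j) = \<rho> (a, x) $$ (i, j) + \<sigma> (a, x) $$ (i, j)"
    and "qform d (asm_add r s \<rho> \<sigma> (a, x)) v = qform d (\<rho> (a, x)) v + qform d (\<sigma> (a, x)) v"
  using assemblage_carrier[OF assms(1,3,4)] assemblage_carrier[OF assms(2,3,4)] assms(3,4)
  by (auto simp: asm_add_def qform_add)

lemma assemblage_scale: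
  assumes "assemblage d r s \<rho>" "0 \<le> c" shows "assemblage d r s (asm_scale r s c \<rho>)"
  unfolding assemblage_iff_entries
proof (intro conjI allI impI)
  fix x y i j assume ij: "x < s" "y < s" "i < d" "j < d"
  have "(\<Sum>a<r. asm_scale r s c \<rho> (a, x) $$ (i, j)) = of_real c * (\<Sum>a<r. \<rho> (a, x) $$ (i, j))" if "x < s" for x
    using ij that by (simp add: asm_scale_index[OF assms(1)] sum_distrib_left)
  then show "(\<Sum>a<r. asm_scale r s c \<rho> (a, x) $$ (i, j)) = (\<Sum>a<r. asm_scale r s c \<rho> (a, y) $$ (i, j))"
    using assemblage_no_signaling[OF assms(1) ij] ij by simp
qed (use assms in \<open>auto simp: asm_scale_def assemblage_def psd_smult\<close>)

lemma assemblage_add: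
  assumes "assemblage d r s \<rho>" "assemblage d r s \<sigma>" shows "assemblage d r s (asm_add r s \<rho> \<sigma>)"
  unfolding assemblage_iff_entries
proof (intro conjI allI impI)
  fix x y i j assume ij: "x < s" "y < s" "i < d" "j < d"
  have "(\<Sum>a<r. asm_add r s \<rho> \<sigma> (a, x) $$ (i, j)) =
      (\<Sum>a<r. \<rho> (a, x) $$ (i, j)) + (\<Sum>a<r. \<sigma> (a, x) $$ (i, j))" if "x < s" for x
    using ij that by (simp add: asm_add_index[OF assms] sum.distrib)
  then show "(\<Sum>a<r. asm_add r s \<rho> \<sigma> (a, x) $$ (i, j)) = (\<Sum>a<r. asm_add r s \<rho> \<sigma> (a, y) $$ (i, j))"
    using assemblage_no_signaling[OF assms(1) ij] assemblage_no_signaling[OF assms(2) ij] ij by simp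
qed (use assms in \<open>auto simp: asm_add_def assemblage_def psd_add\<close>)

section \<open>Trace of an assemblage\<close>

lemma asm_trace_eq: "asm_trace d r \<rho> = (\<Sum>i<d. \<Sum>a<r. \<rho> (a, 0) $$ (i, i))"
  by (simp add: asm_trace_def mat_trace_def reduced_def)

lemma asm_trace_eq_sum_trace:
  assumes "assemblage d r s \<rho>" "x < s"
  shows "asm_trace d r \<rho> = (\<Sum>a<r. mat_trace (\<rho> (a, x)))"
proof -
  have "0 < s"
    using assms by simp
  have "asm_trace d r \<rho> = (\<Sum>i<d. \<Sum>a<r. \<rho> (a, x) $$ (i, i))"
    unfolding asm_trace_eq using assms \<open>0 < s\<close>
    by (intro sum.cong refl assemblage_no_signaling[OF assms(1)]) auto
  also have "\<dots> = (\<Sum>a<r. \<Sum>i<d. \<rho> (a, x) $$ (i, i))"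
    by (rule sum.swap)
  also have "\<dots> = (\<Sum>a<r. mat_trace (\<rho> (a, x)))"
    using assemblage_carrier[OF assms(1) _ assms(2)] by (auto simp: mat_trace_def intro!: sum.cong)
  finally show ?thesis .
qed

lemma asm_trace_scale:
  assumes "assemblage d r s \<rho>" shows "asm_trace d r (asm_scale r s c \<rho>) = of_real c * asm_trace d r \<rho>"
proof -
  have "0 < s"
    using assms by (simp add: assemblage_def)
  then show ?thesis
    by (simp add: asm_trace_eq asm_scale_index[OF assms] sum_distrib_left)
qed

lemma asm_trace_add:
  assumes "assemblage d r s \<rho>" "assemblage d r s \<sigma>"
  shows "asm_trace d r (asm_add r s \<rho> \<sigma>) = asm_trace d r \<rho> + asm_trace d r \<sigma>"
proof -
  have "0 < s"
    using assms by (simp add: assemblage_def)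
  then show ?thesis
    by (simp add: asm_trace_eq asm_add_index[OF assms] sum.distrib)
qed

lemma asm_trace_nonneg: "assemblage d r s \<rho> \<Longrightarrow> 0 \<le> asm_trace d r \<rho>"
  unfolding asm_trace_eq by (intro sum_nonneg psd_diag_nonneg[of d]) (auto simp: assemblage_def)

text \<open>By no-signaling the trace may be computed at the input \<open>x\<close> instead of 0. It
  is then a sum of nonnegative traces, all of which must vanish.\<close>

lemma asm_trace_zero:
  assumes "assemblage d r s \<rho>" "asm_trace d r \<rho> = 0" "a < r" "x < s"
  shows "\<rho> (a, x) = 0\<^sub>m d d"
proof (rule psd_trace_zero)
  have psd: "psd d (\<rho> (b, x))" if "b < r" for b
    using assms that by (simp add: assemblage_def)
  show "psd d (\<rho> (a, x))"
    using psd assms by simp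
  have "(\<Sum>b<r. mat_trace (\<rho> (b, x))) = 0"
    using assms asm_trace_eq_sum_trace by metis
  then show "mat_trace (\<rho> (a, x)) = 0"
    using psd psd_trace_nonneg assms(3) by (subst (asm) sum_nonneg_eq_0_iff) auto
qed

section \<open>Hidden state models with deterministic strategies\<close>

text \<open>Extensional functions, so that only the answers to the \<open>s\<close> inputs count and
  the set is finite.\<close>

definition strategies :: "nat \<Rightarrow> nat \<Rightarrow> (nat \<Rightarrow> nat) set" where
  "strategies r s = {..<s} \<rightarrow>\<^sub>E {..<r}"

text \<open>The operators are not normalised and absorb the probabilities of the strategies. A
  deterministic response has probability 0 or 1, so it becomes a condition on the index set of the
  sum.\<close>

definition hidden :: "nat \<Rightarrow> nat \<Rightarrow> nat \<Rightarrow> ((nat \<Rightarrow> nat) \<Rightarrow> complex mat) \<Rightarrow> family" where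
  "hidden d r s \<xi> =
     restrict (\<lambda>(a, x). msum d d \<xi> {f \<in> strategies r s. f x = a}) ({..<r} \<times> {..<s})"

text \<open>The convex cone over the assemblages in \<open>LHS\<close>: it is closed under
  nonnegative scaling and addition and contains the zero family.\<close>

definition unsteerable :: "nat \<Rightarrow> nat \<Rightarrow> nat \<Rightarrow> family \<Rightarrow> bool" where
  "unsteerable d r s \<tau> \<longleftrightarrow> 1 \<le> d \<and> 1 \<le> r \<and> 1 \<le> s \<and>
     (\<exists>\<xi>. (\<forall>f\<in>strategies r s. psd d (\<xi> f)) \<and> \<tau> = hidden d r s \<xi>)"

lemma finite_strategies [simp]: "finite (strategies r s)"
  by (simp add: strategies_def finite_PiE)

lemma strategies_less: "f \<in> strategies r s \<Longrightarrow> x < s \<Longrightarrow> f x < r"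
  by (auto simp: strategies_def PiE_iff)

lemma hidden_apply [simp]:
  "a < r \<Longrightarrow> x < s \<Longrightarrow> hidden d r s \<xi> (a, x) = msum d d \<xi> {f \<in> strategies r s. f x = a}"
  by (simp add: hidden_def)

text \<open>Every strategy gives exactly one answer to \<open>x\<close>, so grouping by the answer
  exhausts the strategies. The result is free of \<open>x\<close>, which is no-signaling.\<close>

lemma sum_hidden:
  assumes "x < s" "i < d" "j < d"
  shows "(\<Sum>a<r. hidden d r s \<xi> (a, x) $$ (i, j)) = (\<Sum>f\<in>strategies r s. \<xi> f $$ (i, j))"
proof -
  have "(\<Sum>a<r. hidden d r s \<xi> (a, x) $$ (i, j)) =
      (\<Sum>a<r. \<Sum>f\<in>{f \<in> strategies r s. f x = a}. \<xi> f $$ (i, j))"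
    using assms by simp
  also have "\<dots> = (\<Sum>f\<in>strategies r s. \<xi> f $$ (i, j))"
    using assms by (intro sum.group) (auto simp: strategies_less)
  finally show ?thesis .
qed

lemma asm_trace_hidden:
  "1 \<le> s \<Longrightarrow> asm_trace d r (hidden d r s \<xi>) = (\<Sum>f\<in>strategies r s. \<Sum>i<d. \<xi> f $$ (i, i))"
  unfolding asm_trace_eq by (subst sum.swap[of _ "{..<d}" "strategies r s"]) (simp add: sum_hidden del: hidden_apply)

lemma unsteerable_hidden:
  "1 \<le> d \<Longrightarrow> 1 \<le> r \<Longrightarrow> 1 \<le> s \<Longrightarrow> (\<And>f. f \<in> strategies r s \<Longrightarrow> psd d (\<xi> f)) \<Longrightarrow>
    unsteerable d r s (hidden d r s \<xi>)"
  by (auto simp: unsteerable_def)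

lemma unsteerable_assemblage:
  assumes "unsteerable d r s \<tau>" shows "assemblage d r s \<tau>"
proof -
  obtain \<xi> where "\<forall>f\<in>strategies r s. psd d (\<xi> f)" "\<tau> = hidden d r s \<xi>"
    using assms by (auto simp: unsteerable_def)
  moreover have "hidden d r s \<xi> \<in> extensional ({..<r} \<times> {..<s})"
    by (simp add: hidden_def)
  moreover have "(\<Sum>a<r. hidden d r s \<xi> (a, x) $$ (i, j)) = (\<Sum>a<r. hidden d r s \<xi> (a, y) $$ (i, j))"
    if "x < s" "y < s" "i < d" "j < d" for x y i j
    using that by (simp add: sum_hidden del: hidden_apply)
  moreover have "psd d (hidden d r s \<xi> (a, x))" if "a < r" "x < s" for a x
    using that \<open>\<forall>f\<in>strategies r s. psd d (\<xi> f)\<close> by (auto intro: psd_msum)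
  ultimately show ?thesis
    using assms unfolding assemblage_iff_entries unsteerable_def by blast
qed

text \<open>Choosing the answers to all inputs independently turns response functions into random
  deterministic strategies.\<close>

lemma sum_strategies_prod:
  fixes p :: "nat \<Rightarrow> nat \<Rightarrow> real"
  assumes "x < s" "a < r" "\<And>y. y < s \<Longrightarrow> (\<Sum>b<r. p b y) = 1"
  shows "(\<Sum>f\<in>{f \<in> strategies r s. f x = a}. \<Prod>y<s. p (f y) y) = p a x"
proof -
  let ?B = "\<lambda>y. if y = x then {a} else {..<r}"
  have "{f \<in> strategies r s. f x = a} = PiE {..<s} ?B"
    using assms(1,2) unfolding strategies_def set_eq_iff mem_Collect_eq PiE_iff
    by (auto split: if_splits)
  then have "(\<Sum>f\<in>{f \<in> strategies r s. f x = a}. \<Prod>y<s. p (f y) y) =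
      (\<Prod>y<s. \<Sum>b\<in>?B y. p b y)"
    by (subst prod_sum_PiE) auto
  also have "\<dots> = (\<Prod>y<s. if y = x then p a x else 1)"
    using assms by (intro prod.cong) auto
  finally show ?thesis
    using assms(1) by simp
qed

text \<open>The type of the hidden variable is arbitrary, because the rule is used with natural
  numbers, with strategies and with a single point. As in \<open>hidden\<close>, the probabilities
  of its values are absorbed in the operators.\<close>

lemma unsteerableI:
  assumes "1 \<le> d" "1 \<le> r" "1 \<le> s" "\<tau> \<in> extensional ({..<r} \<times> {..<s})"
    and "\<And>x l. x < s \<Longrightarrow> l \<in> \<Lambda> \<Longrightarrow> prob_dist {..<r} (\<lambda>a. p a x l)"
    and psd: "\<And>l. l \<in> \<Lambda> \<Longrightarrow> psd d (\<xi> l)"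
    and \<tau>: "\<And>a x. a < r \<Longrightarrow> x < s \<Longrightarrow> \<tau> (a, x) = msum d d (\<lambda>l. complex_of_real (p a x l) \<cdot>\<^sub>m \<xi> l) \<Lambda>"
  shows "unsteerable d r s \<tau>"
proof -
  \<comment> \<open>The weight of \<xi> l is the probability that \<open>l\<close>, answering all
    inputs independently, realises the strategy \<open>f\<close>.\<close>
  define \<zeta> where "\<zeta> f = msum d d (\<lambda>l. complex_of_real (\<Prod>y<s. p (f y) y l) \<cdot>\<^sub>m \<xi> l) \<Lambda>" for f
  have "psd d (\<zeta> f)" if "f \<in> strategies r s" for f
    unfolding \<zeta>_def
  proof (intro psd_msum psd_smult psd prod_nonneg ballI)
    fix l y assume "l \<in> \<Lambda>" "y \<in> {..<s}"
    then show "0 \<le> p (f y) y l"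
      using assms(5)[of y l] that by (simp add: prob_dist_def strategies_less)
  qed
  moreover have "\<tau> = hidden d r s \<zeta>"
  proof (rule extensionalityI[of _ "{..<r} \<times> {..<s}"])
    fix q assume "q \<in> {..<r} \<times> {..<s}"
    then obtain a x where q: "q = (a, x)" "a < r" "x < s"
      by auto
    show "\<tau> q = hidden d r s \<zeta> q"
    proof (rule eq_matI)
      fix i j assume "i < dim_row (hidden d r s \<zeta> q)" "j < dim_col (hidden d r s \<zeta> q)"
      then have ij: "i < d" "j < d"
        using q by auto
      have entry: "(complex_of_real c \<cdot>\<^sub>m \<xi> l) $$ (i, j) = of_real c * \<xi> l $$ (i, j)" if "l \<in> \<Lambda>" for c l
        using psd[OF that, THEN psd_carrier] ij by auto
      have "hidden d r s \<zeta> q $$ (i, j) =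
          (\<Sum>f\<in>{f \<in> strategies r s. f x = a}. \<Sum>l\<in>\<Lambda>. of_real (\<Prod>y<s. p (f y) y l) * \<xi> l $$ (i, j))"
        using q ij by (simp add: \<zeta>_def entry del: of_real_prod)
      also have "\<dots> = (\<Sum>l\<in>\<Lambda>. of_real (\<Sum>f\<in>{f \<in> strategies r s. f x = a}. \<Prod>y<s. p (f y) y l) * \<xi> l $$ (i, j))"
        by (subst sum.swap) (simp add: sum_distrib_right del: of_real_prod)
      also have "\<dots> = (\<Sum>l\<in>\<Lambda>. of_real (p a x l) * \<xi> l $$ (i, j))"
        using assms(5) q
        by (intro sum.cong refl, subst sum_strategies_prod) (auto simp: prob_dist_def)
      finally show "\<tau> q $$ (i, j) = hidden d r s \<zeta> q $$ (i, j)"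
        using q ij \<tau> entry by simp
    qed (use q \<tau> in auto)
  qed (use assms in \<open>auto simp: hidden_def\<close>)
  ultimately show ?thesis
    using assms(1-3) by (auto simp: unsteerable_def)
qed

lemma unsteerable_scale:
  assumes "unsteerable d r s \<tau>" "0 \<le> c" shows "unsteerable d r s (asm_scale r s c \<tau>)"
proof -
  obtain \<xi> where psd: "\<forall>f\<in>strategies r s. psd d (\<xi> f)" and \<tau>: "\<tau> = hidden d r s \<xi>"
    using assms by (auto simp: unsteerable_def)
  let ?\<zeta> = "\<lambda>f. complex_of_real c \<cdot>\<^sub>m \<xi> f"
  have "unsteerable d r s (hidden d r s ?\<zeta>)"
    using assms psd by (intro unsteerable_hidden) (auto simp: unsteerable_def psd_smult)
  moreover have "asm_scale r s c \<tau> = hidden d r s ?\<zeta>"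
  proof (rule assemblage_eqI)
    fix a x i j assume ax: "a < r" "x < s" and ij: "i < d" "j < d"
    have "hidden d r s ?\<zeta> (a, x) $$ (i, j) =
        (\<Sum>f\<in>{f \<in> strategies r s. f x = a}. of_real c * \<xi> f $$ (i, j))"
      using psd ax ij by (auto simp: psd_index intro!: sum.cong)
    then show "asm_scale r s c \<tau> (a, x) $$ (i, j) = hidden d r s ?\<zeta> (a, x) $$ (i, j)"
      using ax ij
      by (simp add: asm_scale_index(1)[OF unsteerable_assemblage[OF assms(1)]])
        (simp add: \<tau> sum_distrib_left)
  qed (use assms \<open>unsteerable d r s (hidden d r s ?\<zeta>)\<close> in \<open>auto intro: unsteerable_assemblage assemblage_scale\<close>)
  ultimately show ?thesis
    by simp
qed

lemma unsteerable_add: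
  assumes "unsteerable d r s \<tau>" "unsteerable d r s \<tau>'" shows "unsteerable d r s (asm_add r s \<tau> \<tau>')"
proof -
  obtain \<xi> \<xi>' where psd: "\<forall>f\<in>strategies r s. psd d (\<xi> f)" "\<forall>f\<in>strategies r s. psd d (\<xi>' f)"
    and \<tau>: "\<tau> = hidden d r s \<xi>" "\<tau>' = hidden d r s \<xi>'"
    using assms by (auto simp: unsteerable_def)
  let ?\<zeta> = "\<lambda>f. \<xi> f + \<xi>' f"
  have "unsteerable d r s (hidden d r s ?\<zeta>)"
    using assms psd by (intro unsteerable_hidden) (auto simp: unsteerable_def psd_add)
  moreover have "asm_add r s \<tau> \<tau>' = hidden d r s ?\<zeta>"
  proof (rule assemblage_eqI)
    fix a x i j assume ax: "a < r" "x < s" and ij: "i < d" "j < d"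
    have "hidden d r s ?\<zeta> (a, x) $$ (i, j) =
        (\<Sum>f\<in>{f \<in> strategies r s. f x = a}. (\<xi> f + \<xi>' f) $$ (i, j))"
      using ax ij by simp
    also have "\<dots> = (\<Sum>f\<in>{f \<in> strategies r s. f x = a}. \<xi> f $$ (i, j) + \<xi>' f $$ (i, j))"
      by (rule sum.cong) (use psd ij in \<open>auto simp: psd_index\<close>)
    finally show "asm_add r s \<tau> \<tau>' (a, x) $$ (i, j) = hidden d r s ?\<zeta> (a, x) $$ (i, j)"
      using ax ij
      by (simp add: asm_add_index(1)[OF assms[THEN unsteerable_assemblage]]) (simp add: \<tau> sum.distrib)
  qed (use assms \<open>unsteerable d r s (hidden d r s ?\<zeta>)\<close> in \<open>auto intro: unsteerable_assemblage assemblage_add\<close>)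
  ultimately show ?thesis
    by simp
qed

section \<open>Agreement with the hidden state models of the definition\<close>

lemma prob_dist_reindex:
  assumes "bij_betw g A B" "prob_dist A p" "\<And>i. i \<in> A \<Longrightarrow> q (g i) = p i"
  shows "prob_dist B q"
  using assms sum.reindex_bij_betw[OF assms(1), of q] bij_betw_finite[OF assms(1)]
  by (auto simp: prob_dist_def bij_betw_def)

text \<open>From left to right the probabilities are multiplied into the density operators. From
  right to left the strategy is the hidden variable, the trace of its operator is its probability
  and the rescaled operator is its state; these probabilities add up to the trace of \<sigma>, which
  is 1.\<close>

lemma LHS_iff_unsteerable: "LHS d r s \<sigma> \<longleftrightarrow> normalised d r s \<sigma> \<and> unsteerable d r s \<sigma>"
proof (intro iffI conjI)
  assume L: "LHS d r s \<sigma>"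
  then show norm: "normalised d r s \<sigma>"
    by (simp add: LHS_def)
  obtain \<Lambda> :: "nat set" and P p \<xi> where
    P: "prob_dist \<Lambda> P" "\<forall>x<s. \<forall>l\<in>\<Lambda>. prob_dist {..<r} (\<lambda>a. p a x l)" "\<forall>l\<in>\<Lambda>. density d (\<xi> l)"
    and \<sigma>: "\<forall>a<r. \<forall>x<s. \<sigma> (a, x) = msum d d (\<lambda>l. complex_of_real (P l * p a x l) \<cdot>\<^sub>m \<xi> l) \<Lambda>"
    using L unfolding LHS_def by blast
  show "unsteerable d r s \<sigma>"
  proof (rule unsteerableI)
    show "psd d (complex_of_real (P l) \<cdot>\<^sub>m \<xi> l)" if "l \<in> \<Lambda>" for l
      using P that by (auto simp: prob_dist_def density_def intro: psd_smult)
    show "\<sigma> (a, x) = msum d d (\<lambda>l. complex_of_real (p a x l) \<cdot>\<^sub>m (complex_of_real (P l) \<cdot>\<^sub>m \<xi> l)) \<Lambda>"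
      if "a < r" "x < s" for a x
      using \<sigma> that by (simp add: smult_mat_assoc mult.commute)
  qed (use norm P in \<open>auto simp: normalised_def assemblage_def\<close>)
next
  assume "normalised d r s \<sigma> \<and> unsteerable d r s \<sigma>"
  then obtain \<xi> where norm: "normalised d r s \<sigma>" and psd: "\<forall>f\<in>strategies r s. psd d (\<xi> f)"
    and \<sigma>: "\<sigma> = hidden d r s \<xi>"
    by (auto simp: unsteerable_def)
  have d: "0 < d" "1 \<le> s"
    using norm by (auto simp: normalised_def assemblage_def)
  define t where "t f = Re (mat_trace (\<xi> f))" for f
  have t: "0 \<le> t f" "mat_trace (\<xi> f) = of_real (t f)" if "f \<in> strategies r s" for f
    using psd_trace_nonneg[of d "\<xi> f"] psd that by (auto simp: t_def less_eq_complex_def complex_eq_iff)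
  define \<eta> where "\<eta> = reduced d r \<sigma> 0"
  have \<eta>: "density d \<eta>"
    using norm by (auto simp: \<eta>_def density_def normalised_def asm_trace_def reduced_def assemblage_def
        intro!: psd_msum)
  \<comment> \<open>A strategy of probability 0 has the operator 0 and still needs some density
    operator; the reduced operator of \<sigma> is one at hand.\<close>
  define \<theta> where "\<theta> f = (if t f = 0 then \<eta> else complex_of_real (1 / t f) \<cdot>\<^sub>m \<xi> f)" for f
  have \<theta>: "density d (\<theta> f)" "complex_of_real (t f) \<cdot>\<^sub>m \<theta> f = \<xi> f" if f: "f \<in> strategies r s" for f
  proof -
    have \<xi>: "psd d (\<xi> f)" "\<xi> f \<in> carrier_mat d d"
      using psd f psd_carrier by auto
    have "density d (\<theta> f) \<and> complex_of_real (t f) \<cdot>\<^sub>m \<theta> f = \<xi> f"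
    proof (cases "t f = 0")
      case True
      then have "\<xi> f = 0\<^sub>m d d"
        using psd_trace_zero[OF \<xi>(1)] t(2)[OF f] by simp
      moreover have "\<eta> \<in> carrier_mat d d"
        by (simp add: \<eta>_def reduced_def)
      ultimately show ?thesis
        using True \<eta> by (auto simp: \<theta>_def intro!: eq_matI)
    next
      case False
      have "mat_trace (complex_of_real (1 / t f) \<cdot>\<^sub>m \<xi> f) = of_real (1 / t f) * mat_trace (\<xi> f)"
        using \<xi> by (auto simp: mat_trace_def sum_distrib_left psd_index intro!: sum.cong)
      then have "mat_trace (\<theta> f) = 1"
        using False t(2)[OF f] by (simp add: \<theta>_def)
      then show ?thesis
        using False \<xi> t(1)[OF f] psd_smult[of "1 / t f" d "\<xi> f"]
        by (auto simp: \<theta>_def density_def intro!: eq_matI)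
    qed
    then show "density d (\<theta> f)" "complex_of_real (t f) \<cdot>\<^sub>m \<theta> f = \<xi> f"
      by auto
  qed
  \<comment> \<open>Hidden variables in \<open>LHS\<close> are natural numbers, hence the
    enumeration of the strategies.\<close>
  obtain g :: "nat \<Rightarrow> nat \<Rightarrow> nat" where g: "bij_betw g {..<card (strategies r s)} (strategies r s)"
    using ex_bij_betw_nat_finite[OF finite_strategies] by (metis lessThan_atLeast0)
  let ?\<Lambda> = "{..<card (strategies r s)}"
  have gmem: "g l \<in> strategies r s" if "l \<in> ?\<Lambda>" for l
    using g that by (auto simp: bij_betw_def)
  have "prob_dist (strategies r s) t"
  proof -
    have "(\<Sum>f\<in>strategies r s. complex_of_real (t f)) = asm_trace d r \<sigma>"
      using psd[rule_format, THEN psd_carrier] t(2) d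
      by (auto simp: \<sigma> asm_trace_hidden mat_trace_def simp flip: t(2) intro!: sum.cong)
    then have "of_real (\<Sum>f\<in>strategies r s. t f) = (1 :: complex)"
      using norm by (simp add: normalised_def)
    then show ?thesis
      using t by (simp only: of_real_eq_1_iff) (auto simp: prob_dist_def)
  qed
  then have "prob_dist ?\<Lambda> (t \<circ> g)"
    using prob_dist_reindex[OF bij_betw_inv_into[OF g], of t] g
    by (simp add: bij_betw_inv_into_right)
  moreover have "prob_dist {..<r} (\<lambda>a. if g l x = a then 1 else 0)" if "x < s" "l \<in> ?\<Lambda>" for x l
    using strategies_less[OF gmem[OF that(2)] that(1)] by (auto simp: prob_dist_def)
  moreover have "density d ((\<theta> \<circ> g) l)" if "l \<in> ?\<Lambda>" for l
    using \<theta>(1) gmem[OF that] by simp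
  moreover have "\<sigma> (a, x) = msum d d
      (\<lambda>l. complex_of_real ((t \<circ> g) l * (if g l x = a then 1 else 0)) \<cdot>\<^sub>m (\<theta> \<circ> g) l) ?\<Lambda>"
    if "a < r" "x < s" for a x
  proof (rule eq_matI, goal_cases)
    case (1 i j)
    then have ij: "i < d" "j < d"
      by auto
    let ?h = "\<lambda>f. if f x = a then \<xi> f $$ (i, j) else 0"
    have "(complex_of_real ((t \<circ> g) l * (if g l x = a then 1 else 0)) \<cdot>\<^sub>m (\<theta> \<circ> g) l) $$ (i, j) = ?h (g l)"
      if "l \<in> ?\<Lambda>" for l
      using \<theta>[OF gmem[OF that]] ij
      by (auto simp: density_def dest!: psd_carrier simp flip: \<theta>(2)[OF gmem[OF that]])
    then have "(\<Sum>l\<in>?\<Lambda>. (complex_of_real ((t \<circ> g) l * (if g l x = a then 1 else 0)) \<cdot>\<^sub>m (\<theta> \<circ> g) l) $$ (i, j)) =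
        (\<Sum>f\<in>strategies r s. ?h f)"
      unfolding sum.reindex_bij_betw[OF g, symmetric] by (intro sum.cong) auto
    then show ?case
      using that ij by (simp add: \<sigma> sum.inter_filter)
  qed (use that \<sigma> in auto)
  ultimately show "LHS d r s \<sigma>"
    unfolding LHS_def using norm
    by (intro conjI exI[of _ ?\<Lambda>] exI[of _ "t \<circ> g"] exI[of _ "\<lambda>a x l. if g l x = a then 1 else 0"]
        exI[of _ "\<theta> \<circ> g"]) auto
qed

section \<open>One-way LOCCs\<close>

lemma conjugation_msum:
  assumes "K \<in> carrier_mat m d" "\<And>k. k \<in> I \<Longrightarrow> f k \<in> carrier_mat d d" "i < m" "j < m"
  shows "(K * msum d d f I * mat_adjoint K) $$ (i, j) =
    (\<Sum>k\<in>I. (K * f k * mat_adjoint K) $$ (i, j))"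
proof -
  let ?g = "\<lambda>k l n. K $$ (i, l) * f k $$ (l, n) * cnj (K $$ (j, n))"
  have "(K * msum d d f I * mat_adjoint K) $$ (i, j) = (\<Sum>l<d. \<Sum>n<d. \<Sum>k\<in>I. ?g k l n)"
    using assms by (simp add: conjugation_index sum_distrib_left sum_distrib_right del: index_mult_mat)
  also have "\<dots> = (\<Sum>l<d. \<Sum>k\<in>I. \<Sum>n<d. ?g k l n)"
    by (intro sum.cong refl sum.swap)
  also have "\<dots> = (\<Sum>k\<in>I. \<Sum>l<d. \<Sum>n<d. ?g k l n)"
    by (rule sum.swap)
  also have "\<dots> = (\<Sum>k\<in>I. (K * f k * mat_adjoint K) $$ (i, j))"
    using assms by (intro sum.cong refl) (simp add: conjugation_index del: index_mult_mat)
  finally show ?thesis .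
qed

context
  fixes d r s df rf sf :: nat and M :: locc
  assumes M: "locc_1W d r s df rf sf M"
begin

text \<open>Both classical steps in one number: given the result \<open>a\<close>, the probability
  of feeding in \<open>x\<close> and announcing \<open>af\<close>.\<close>

private definition weight where
  "weight \<omega> af xf a x = input_prob M x xf \<omega> * output_prob M af a x \<omega> xf"

private abbreviation "branch \<equiv> locc_branch r s df rf sf M"

private lemma kraus_carrier: "\<omega> \<in> outcomes M \<Longrightarrow> kraus M \<omega> \<in> carrier_mat df d"
  using M by (simp add: locc_1W_def)

private lemma input_prob: "\<omega> \<in> outcomes M \<Longrightarrow> xf < sf \<Longrightarrow> prob_dist {..<s} (\<lambda>x. input_prob M x xf \<omega>)"
  using M by (simp add: locc_1W_def)

private lemma output_prob:
  "\<omega> \<in> outcomes M \<Longrightarrow> xf < sf \<Longrightarrow> a < r \<Longrightarrow> x < s \<Longrightarrow>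
    prob_dist {..<rf} (\<lambda>af. output_prob M af a x \<omega> xf)"
  using M by (simp add: locc_1W_def)

private lemma weight_nonneg:
  "\<omega> \<in> outcomes M \<Longrightarrow> af < rf \<Longrightarrow> xf < sf \<Longrightarrow> a < r \<Longrightarrow> x < s \<Longrightarrow> 0 \<le> weight \<omega> af xf a x"
  using input_prob output_prob by (auto simp: weight_def prob_dist_def intro!: mult_nonneg_nonneg)

private lemma sum_weight:
  assumes "\<omega> \<in> outcomes M" "xf < sf" "a < r" "x < s"
  shows "(\<Sum>af<rf. weight \<omega> af xf a x) = input_prob M x xf \<omega>"
  using output_prob[OF assms] by (simp add: weight_def prob_dist_def flip: sum_distrib_left)

private lemma branch_apply:
  "af < rf \<Longrightarrow> xf < sf \<Longrightarrow> branch \<omega> \<rho> (af, xf) =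
     msum df df (\<lambda>(a, x). complex_of_real (weight \<omega> af xf a x) \<cdot>\<^sub>m
       (kraus M \<omega> * \<rho> (a, x) * mat_adjoint (kraus M \<omega>))) ({..<r} \<times> {..<s})"
  by (simp add: locc_branch_def weight_def)

text \<open>The sum over \<open>x\<close> stands outside, because no-signaling concerns the sum over
  \<open>a\<close> at a fixed \<open>x\<close>.\<close>

private lemma branch_index:
  assumes \<omega>: "\<omega> \<in> outcomes M" and ax: "af < rf" "xf < sf" and ij: "i < df" "j < df"
  shows "branch \<omega> \<rho> (af, xf) $$ (i, j) = (\<Sum>x<s. \<Sum>a<r. of_real (weight \<omega> af xf a x) *
    (kraus M \<omega> * \<rho> (a, x) * mat_adjoint (kraus M \<omega>)) $$ (i, j))"
proof -
  have K: "kraus M \<omega> * A * mat_adjoint (kraus M \<omega>) \<in> carrier_mat df df" for A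
    using kraus_carrier[OF \<omega>] by (rule conjugation_carrier)
  have "branch \<omega> \<rho> (af, xf) $$ (i, j) = (\<Sum>a<r. \<Sum>x<s. of_real (weight \<omega> af xf a x) *
      (kraus M \<omega> * \<rho> (a, x) * mat_adjoint (kraus M \<omega>)) $$ (i, j))"
    unfolding branch_apply[OF ax] msum_index[OF ij] sum.cartesian_product
    using smult_index[OF K ij] by (intro sum.cong refl) (auto simp del: index_mult_mat index_smult_mat)
  then show ?thesis
    by (subst sum.swap)
qed

lemma qform_locc_branch:
  assumes \<rho>: "assemblage d r s \<rho>" and \<omega>: "\<omega> \<in> outcomes M" and ax: "af < rf" "xf < sf"
  shows "qform df (branch \<omega> \<rho> (af, xf)) v = (\<Sum>(a, x)\<in>{..<r} \<times> {..<s}.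
    of_real (weight \<omega> af xf a x) * qform d (\<rho> (a, x)) (\<lambda>k. \<Sum>i<df. cnj (kraus M \<omega> $$ (i, k)) * v i))"
  unfolding branch_apply[OF ax] qform_msum
  using kraus_carrier[OF \<omega>] assemblage_carrier[OF \<rho>]
  by (intro sum.cong refl) (auto simp: qform_smult qform_conjugation conjugation_carrier)

text \<open>The right-hand side is an entry of the reduced operator of \<rho> conjugated by the
  Kraus operator. Summing over \<open>af\<close> removes the output probabilities; then the sum over
  \<open>a\<close> gives this entry for every \<open>x\<close> alike, by no-signaling, and the input
  probabilities sum to 1. Both the no-signaling and the trace of a branch follow from it.\<close>

private lemma sum_branch:
  assumes \<rho>: "assemblage d r s \<rho>" and \<omega>: "\<omega> \<in> outcomes M" and xf: "xf < sf" and ij: "i < df" "j < df"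
  shows "(\<Sum>af<rf. branch \<omega> \<rho> (af, xf) $$ (i, j)) =
    (\<Sum>k<d. \<Sum>l<d. kraus M \<omega> $$ (i, k) * (\<Sum>a<r. \<rho> (a, 0) $$ (k, l)) * cnj (kraus M \<omega> $$ (j, l)))"
    (is "_ = ?R")
proof -
  let ?Z = "\<lambda>a x. (kraus M \<omega> * \<rho> (a, x) * mat_adjoint (kraus M \<omega>)) $$ (i, j)"
  have s: "0 < s"
    using \<rho> by (simp add: assemblage_def)
  have Z: "(\<Sum>a<r. ?Z a x) = ?R" if x: "x < s" for x
  proof -
    have "(\<Sum>a<r. ?Z a x) = (\<Sum>a<r. \<Sum>k<d. \<Sum>l<d.
        kraus M \<omega> $$ (i, k) * \<rho> (a, x) $$ (k, l) * cnj (kraus M \<omega> $$ (j, l)))"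
      using kraus_carrier[OF \<omega>] assemblage_carrier[OF \<rho>] x ij
      by (intro sum.cong refl conjugation_index) auto
    also have "\<dots> = (\<Sum>k<d. \<Sum>a<r. \<Sum>l<d.
        kraus M \<omega> $$ (i, k) * \<rho> (a, x) $$ (k, l) * cnj (kraus M \<omega> $$ (j, l)))"
      by (rule sum.swap)
    also have "\<dots> = (\<Sum>k<d. \<Sum>l<d. \<Sum>a<r.
        kraus M \<omega> $$ (i, k) * \<rho> (a, x) $$ (k, l) * cnj (kraus M \<omega> $$ (j, l)))"
      by (intro sum.cong refl sum.swap)
    also have "\<dots> = (\<Sum>k<d. \<Sum>l<d.
        kraus M \<omega> $$ (i, k) * (\<Sum>a<r. \<rho> (a, x) $$ (k, l)) * cnj (kraus M \<omega> $$ (j, l)))"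
      by (simp add: sum_distrib_left sum_distrib_right)
    also have "\<dots> = ?R"
      using assemblage_no_signaling[OF \<rho> x s] by (intro sum.cong refl) simp
    finally show ?thesis .
  qed
  have "(\<Sum>af<rf. branch \<omega> \<rho> (af, xf) $$ (i, j)) =
      (\<Sum>af<rf. \<Sum>x<s. \<Sum>a<r. of_real (weight \<omega> af xf a x) * ?Z a x)"
    using branch_index[OF \<omega> _ xf ij] by (intro sum.cong refl) auto
  also have "\<dots> = (\<Sum>x<s. \<Sum>af<rf. \<Sum>a<r. of_real (weight \<omega> af xf a x) * ?Z a x)"
    by (rule sum.swap)
  also have "\<dots> = (\<Sum>x<s. \<Sum>a<r. \<Sum>af<rf. of_real (weight \<omega> af xf a x) * ?Z a x)"
    by (intro sum.cong refl sum.swap)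
  also have "\<dots> = (\<Sum>x<s. \<Sum>a<r. of_real (\<Sum>af<rf. weight \<omega> af xf a x) * ?Z a x)"
    by (simp add: sum_distrib_right del: index_mult_mat)
  also have "\<dots> = (\<Sum>x<s. of_real (input_prob M x xf \<omega>) * (\<Sum>a<r. ?Z a x))"
    using sum_weight[OF \<omega> xf] unfolding sum_distrib_left by (intro sum.cong refl) simp
  also have "\<dots> = (\<Sum>x<s. of_real (input_prob M x xf \<omega>) * ?R)"
    using Z by (intro sum.cong refl) simp
  also have "\<dots> = of_real (\<Sum>x<s. input_prob M x xf \<omega>) * ?R"
    unfolding of_real_sum sum_distrib_right ..
  also have "\<dots> = ?R"
    using input_prob[OF \<omega> xf] by (simp add: prob_dist_def)
  finally show ?thesis .
qed

lemma assemblage_locc_branch: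
  assumes "assemblage d r s \<rho>" "\<omega> \<in> outcomes M"
  shows "assemblage df rf sf (branch \<omega> \<rho>)"
  unfolding assemblage_iff_entries
proof (intro conjI allI impI)
  fix af xf assume "af < rf" "xf < sf"
  then show "psd df (branch \<omega> \<rho> (af, xf))"
    using assms kraus_carrier weight_nonneg
    by (auto simp: branch_apply assemblage_def intro!: psd_msum psd_smult psd_conjugation)
next
  fix xf yf i j assume "xf < sf" "yf < sf" "i < df" "j < df"
  \<comment> \<open>The value found in \<open>sum_branch\<close> does not mention the input of the
    branch.\<close>
  then show "(\<Sum>af<rf. branch \<omega> \<rho> (af, xf) $$ (i, j)) = (\<Sum>af<rf. branch \<omega> \<rho> (af, yf) $$ (i, j))"
    by (simp only: sum_branch[OF assms])
qed (use M in \<open>auto simp: locc_1W_def locc_branch_def\<close>)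

text \<open>The completeness relation of the Kraus operators is the identity \<open>\<delta>\<close> in the middle.\<close>

lemma sum_asm_trace_locc_branch:
  assumes \<rho>: "assemblage d r s \<rho>"
  shows "(\<Sum>\<omega>\<in>outcomes M. asm_trace df rf (branch \<omega> \<rho>)) = asm_trace d r \<rho>"
proof -
  let ?R = "\<lambda>k l. \<Sum>a<r. \<rho> (a, 0) $$ (k, l)"
  let ?g = "\<lambda>\<omega> i k l. ?R k l * (cnj (kraus M \<omega> $$ (i, l)) * kraus M \<omega> $$ (i, k))"
  have sf: "0 < sf"
    using M by (simp add: locc_1W_def)
  have \<delta>: "(\<Sum>\<omega>\<in>outcomes M. \<Sum>i<df. cnj (kraus M \<omega> $$ (i, l)) * kraus M \<omega> $$ (i, k)) = (if l = k then 1 else 0)"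
    if "k < d" "l < d" for k l
  proof -
    have "(\<Sum>\<omega>\<in>outcomes M. \<Sum>i<df. cnj (kraus M \<omega> $$ (i, l)) * kraus M \<omega> $$ (i, k)) =
        msum d d (\<lambda>\<omega>. mat_adjoint (kraus M \<omega>) * kraus M \<omega>) (outcomes M) $$ (l, k)"
      unfolding msum_index[OF that(2,1)] using that kraus_carrier
      by (intro sum.cong refl) (auto simp: scalar_prod_def lessThan_atLeast0 dest!: kraus_carrier)
    also have "\<dots> = 1\<^sub>m d $$ (l, k)"
      using M by (simp add: locc_1W_def)
    finally show ?thesis
      using that by simp
  qed
  have "asm_trace df rf (branch \<omega> \<rho>) = (\<Sum>k<d. \<Sum>l<d. \<Sum>i<df. ?g \<omega> i k l)"
    if \<omega>: "\<omega> \<in> outcomes M" for \<omega>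
  proof -
    have "(\<Sum>af<rf. branch \<omega> \<rho> (af, 0) $$ (i, i)) = (\<Sum>k<d. \<Sum>l<d. ?g \<omega> i k l)" if "i < df" for i
      unfolding sum_branch[OF \<rho> \<omega> sf that that] by (intro sum.cong refl) (simp add: mult_ac)
    then have "asm_trace df rf (branch \<omega> \<rho>) = (\<Sum>i<df. \<Sum>k<d. \<Sum>l<d. ?g \<omega> i k l)"
      by (simp add: asm_trace_eq)
    also have "\<dots> = (\<Sum>k<d. \<Sum>i<df. \<Sum>l<d. ?g \<omega> i k l)"
      by (rule sum.swap)
    also have "\<dots> = (\<Sum>k<d. \<Sum>l<d. \<Sum>i<df. ?g \<omega> i k l)"
      by (intro sum.cong refl sum.swap)
    finally show ?thesis .
  qed
  then have "(\<Sum>\<omega>\<in>outcomes M. asm_trace df rf (branch \<omega> \<rho>)) =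
      (\<Sum>\<omega>\<in>outcomes M. \<Sum>k<d. \<Sum>l<d. \<Sum>i<df. ?g \<omega> i k l)"
    by simp
  also have "\<dots> = (\<Sum>k<d. \<Sum>\<omega>\<in>outcomes M. \<Sum>l<d. \<Sum>i<df. ?g \<omega> i k l)"
    by (rule sum.swap)
  also have "\<dots> = (\<Sum>k<d. \<Sum>l<d. \<Sum>\<omega>\<in>outcomes M. \<Sum>i<df. ?g \<omega> i k l)"
    by (intro sum.cong refl sum.swap)
  also have "\<dots> = (\<Sum>k<d. \<Sum>l<d. ?R k l * (if l = k then 1 else 0))"
    unfolding sum_distrib_left[symmetric] using \<delta> by (intro sum.cong refl) simp
  also have "\<dots> = asm_trace d r \<rho>"
    by (simp add: asm_trace_eq if_distrib cong: if_cong)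
  finally show ?thesis .
qed

text \<open>The old strategies remain the hidden variables, with conjugated operators. The response
  to \<open>xf\<close> is now random: draw \<open>x\<close>, answer \<open>f x\<close>, process the
  answer. \<open>unsteerableI\<close> converts these random responses into strategies for the new
  parameters.\<close>

lemma unsteerable_locc_branch:
  assumes \<tau>: "unsteerable d r s \<tau>" and \<omega>: "\<omega> \<in> outcomes M"
  shows "unsteerable df rf sf (branch \<omega> \<tau>)"
proof -
  obtain \<xi> where psd: "\<forall>f\<in>strategies r s. psd d (\<xi> f)" and \<tau>_eq: "\<tau> = hidden d r s \<xi>"
    using \<tau> by (auto simp: unsteerable_def)
  let ?\<zeta> = "\<lambda>f. kraus M \<omega> * \<xi> f * mat_adjoint (kraus M \<omega>)"
  let ?p = "\<lambda>af xf f. \<Sum>x<s. weight \<omega> af xf (f x) x"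
  show ?thesis
  proof (rule unsteerableI)
    show "psd df (?\<zeta> f)" if "f \<in> strategies r s" for f
      using psd that kraus_carrier[OF \<omega>] by (auto intro: psd_conjugation)
    show "prob_dist {..<rf} (\<lambda>af. ?p af xf f)" if xf: "xf < sf" and f: "f \<in> strategies r s" for xf f
    proof -
      have "(\<Sum>af<rf. ?p af xf f) = (\<Sum>x<s. \<Sum>af<rf. weight \<omega> af xf (f x) x)"
        by (rule sum.swap)
      also have "\<dots> = (\<Sum>x<s. input_prob M x xf \<omega>)"
        using sum_weight[OF \<omega> xf] strategies_less[OF f] by (intro sum.cong refl) simp
      also have "\<dots> = 1"
        using input_prob[OF \<omega> xf] by (simp add: prob_dist_def)
      finally show ?thesis
        using weight_nonneg[OF \<omega> _ xf] strategies_less[OF f] by (auto simp: prob_dist_def intro!: sum_nonneg)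
    qed
    show "branch \<omega> \<tau> (af, xf) = msum df df (\<lambda>f. complex_of_real (?p af xf f) \<cdot>\<^sub>m ?\<zeta> f) (strategies r s)"
      if ax: "af < rf" "xf < sf" for af xf
    proof (rule eq_matI)
      fix i j
      assume "i < dim_row (msum df df (\<lambda>f. complex_of_real (?p af xf f) \<cdot>\<^sub>m ?\<zeta> f) (strategies r s))"
        "j < dim_col (msum df df (\<lambda>f. complex_of_real (?p af xf f) \<cdot>\<^sub>m ?\<zeta> f) (strategies r s))"
      then have ij: "i < df" "j < df"
        by auto
      have conj: "(kraus M \<omega> * msum d d \<xi> {f \<in> strategies r s. f x = a} * mat_adjoint (kraus M \<omega>)) $$ (i, j) =
          (\<Sum>f\<in>{f \<in> strategies r s. f x = a}. ?\<zeta> f $$ (i, j))" for a x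
        by (rule conjugation_msum[OF kraus_carrier[OF \<omega>] _ ij]) (use psd psd_carrier in auto)
      let ?w = "\<lambda>a x. complex_of_real (weight \<omega> af xf a x)"
      have "branch \<omega> \<tau> (af, xf) $$ (i, j) =
          (\<Sum>x<s. \<Sum>a<r. ?w a x * (\<Sum>f\<in>{f \<in> strategies r s. f x = a}. ?\<zeta> f $$ (i, j)))"
        unfolding branch_index[OF \<omega> ax ij] using conj by (intro sum.cong refl) (simp add: \<tau>_eq)
      also have "\<dots> = (\<Sum>x<s. \<Sum>a<r. \<Sum>f\<in>{f \<in> strategies r s. f x = a}. ?w (f x) x * ?\<zeta> f $$ (i, j))"
        unfolding sum_distrib_left by (intro sum.cong refl) auto
      also have "\<dots> = (\<Sum>x<s. \<Sum>f\<in>strategies r s. ?w (f x) x * ?\<zeta> f $$ (i, j))"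
        by (intro sum.cong refl sum.group) (auto simp: strategies_less)
      also have "\<dots> = (\<Sum>f\<in>strategies r s. \<Sum>x<s. ?w (f x) x * ?\<zeta> f $$ (i, j))"
        by (rule sum.swap)
      also have "\<dots> = (\<Sum>f\<in>strategies r s. of_real (?p af xf f) * ?\<zeta> f $$ (i, j))"
        unfolding of_real_sum sum_distrib_right ..
      also have "\<dots> = msum df df (\<lambda>f. complex_of_real (?p af xf f) \<cdot>\<^sub>m ?\<zeta> f) (strategies r s) $$ (i, j)"
        unfolding msum_index[OF ij] using smult_index[OF conjugation_carrier[OF kraus_carrier[OF \<omega>]] ij]
        by (intro sum.cong refl) simp
      finally show "branch \<omega> \<tau> (af, xf) $$ (i, j) =
          msum df df (\<lambda>f. complex_of_real (?p af xf f) \<cdot>\<^sub>m ?\<zeta> f) (strategies r s) $$ (i, j)" .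
    qed (use ax in \<open>auto simp: branch_apply\<close>)
  qed (use M in \<open>auto simp: locc_1W_def locc_branch_def\<close>)
qed

text \<open>A branch is linear and positive: its form at \<open>v\<close> is a combination, with
  nonnegative weights, of the forms of the input family at one vector \<open>u\<close>, the same for
  \<rho> and for \<tau>.\<close>

lemma locc_branch_dominance:
  fixes e :: real
  assumes "assemblage d r s \<rho>" "assemblage d r s \<tau>" and \<omega>: "\<omega> \<in> outcomes M" and ax: "af < rf" "xf < sf"
    and dom: "\<And>a x v. a < r \<Longrightarrow> x < s \<Longrightarrow> 0 \<le> of_real e * (qform d (\<rho> (a, x)) v - qform d (\<tau> (a, x)) v)"
  shows "0 \<le> of_real e * (qform df (branch \<omega> \<rho> (af, xf)) v - qform df (branch \<omega> \<tau> (af, xf)) v)"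
proof -
  define u where "u k = (\<Sum>i<df. cnj (kraus M \<omega> $$ (i, k)) * v i)" for k
  have "of_real e * (qform df (branch \<omega> \<rho> (af, xf)) v - qform df (branch \<omega> \<tau> (af, xf)) v) =
      (\<Sum>(a, x)\<in>{..<r} \<times> {..<s}. of_real (weight \<omega> af xf a x) *
        (of_real e * (qform d (\<rho> (a, x)) u - qform d (\<tau> (a, x)) u)))"
    using assms(1,2) by (simp add: qform_locc_branch \<omega> ax u_def[abs_def] sum_subtractf[symmetric]
        sum_distrib_left case_prod_unfold algebra_simps)
  also have "0 \<le> \<dots>"
    using weight_nonneg[OF \<omega> ax] dom
    by (intro sum_nonneg) (auto simp: less_eq_complex_def intro!: mult_nonneg_nonneg)
  finally show ?thesis .
qed

end

section \<open>Optimal unsteerable parts\<close>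

text \<open>The sign \<open>e = 1\<close> belongs to the steerable weight, \<open>e = -1\<close> to the robustness.\<close>

definition decomposable :: "real \<Rightarrow> nat \<Rightarrow> nat \<Rightarrow> nat \<Rightarrow> family \<Rightarrow> real \<Rightarrow> bool" where
  "decomposable e d r s \<rho> \<nu> \<longleftrightarrow> (\<exists>\<tau>. unsteerable d r s \<tau> \<and>
     (\<forall>a<r. \<forall>x<s. \<forall>v. 0 \<le> of_real e * (qform d (\<rho> (a, x)) v - qform d (\<tau> (a, x)) v)) \<and>
     of_real \<nu> = of_real e * (asm_trace d r \<rho> - asm_trace d r \<tau>))"

text \<open>\<nu> is a sum of diagonal entries of the signed difference at the input 0, and these
  are values of its form at unit vectors.\<close>

lemma decomposable_nonneg:
  assumes "decomposable e d r s \<rho> \<nu>" shows "0 \<le> \<nu>"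
proof -
  obtain \<tau> where \<tau>: "unsteerable d r s \<tau>"
    and dom: "\<And>a x v. a < r \<Longrightarrow> x < s \<Longrightarrow> 0 \<le> complex_of_real e * (qform d (\<rho> (a, x)) v - qform d (\<tau> (a, x)) v)"
    and \<nu>: "of_real \<nu> = of_real e * (asm_trace d r \<rho> - asm_trace d r \<tau>)"
    using assms by (auto simp: decomposable_def)
  have s: "0 < s"
    using \<tau> by (simp add: unsteerable_def)
  have "of_real \<nu> = (\<Sum>i<d. \<Sum>a<r. of_real e * (\<rho> (a, 0) $$ (i, i) - \<tau> (a, 0) $$ (i, i)))"
    by (simp add: \<nu> asm_trace_eq sum_subtractf sum_distrib_left right_diff_distrib)
  also have "0 \<le> \<dots>"
    using dom s by (intro sum_nonneg) (metis lessThan_iff qform_unit)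
  finally show ?thesis
    by (simp add: less_eq_complex_def)
qed

lemma decomposable_scale:
  assumes "assemblage d r s \<rho>" "decomposable e d r s \<rho> \<nu>" "0 \<le> c"
  shows "decomposable e d r s (asm_scale r s c \<rho>) (c * \<nu>)"
proof -
  obtain \<tau> where \<tau>: "unsteerable d r s \<tau>"
    and dom: "\<And>a x v. a < r \<Longrightarrow> x < s \<Longrightarrow> 0 \<le> complex_of_real e * (qform d (\<rho> (a, x)) v - qform d (\<tau> (a, x)) v)"
    and \<nu>: "of_real \<nu> = of_real e * (asm_trace d r \<rho> - asm_trace d r \<tau>)"
    using assms(2) by (auto simp: decomposable_def)
  note asm = assms(1) unsteerable_assemblage[OF \<tau>]
  show ?thesis
    unfolding decomposable_def
  proof (intro exI[of _ "asm_scale r s c \<tau>"] conjI allI impI)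
    fix a x v assume "a < r" "x < s"
    moreover from this have "0 \<le> of_real c * (complex_of_real e * (qform d (\<rho> (a, x)) v - qform d (\<tau> (a, x)) v))"
      using assms(3) by (intro mult_nonneg_nonneg[OF _ dom]) (simp_all add: less_eq_complex_def)
    ultimately show "0 \<le> complex_of_real e *
        (qform d (asm_scale r s c \<rho> (a, x)) v - qform d (asm_scale r s c \<tau> (a, x)) v)"
      by (simp add: asm_scale_index[OF asm(1)] asm_scale_index[OF asm(2)] algebra_simps)
  qed (use assms(3) \<tau> in \<open>auto simp: \<nu> unsteerable_scale asm[THEN asm_trace_scale] algebra_simps\<close>)
qed

lemma decomposable_add:
  assumes "assemblage d r s \<rho>" "assemblage d r s \<rho>'"
    and "decomposable e d r s \<rho> \<nu>" "decomposable e d r s \<rho>' \<nu>'"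
  shows "decomposable e d r s (asm_add r s \<rho> \<rho>') (\<nu> + \<nu>')"
proof -
  obtain \<tau> where \<tau>: "unsteerable d r s \<tau>"
    and dom: "\<And>a x v. a < r \<Longrightarrow> x < s \<Longrightarrow> 0 \<le> complex_of_real e * (qform d (\<rho> (a, x)) v - qform d (\<tau> (a, x)) v)"
    and \<nu>: "of_real \<nu> = of_real e * (asm_trace d r \<rho> - asm_trace d r \<tau>)"
    using assms(3) by (auto simp: decomposable_def)
  obtain \<tau>' where \<tau>': "unsteerable d r s \<tau>'"
    and dom': "\<And>a x v. a < r \<Longrightarrow> x < s \<Longrightarrow> 0 \<le> complex_of_real e * (qform d (\<rho>' (a, x)) v - qform d (\<tau>' (a, x)) v)"
    and \<nu>': "of_real \<nu>' = of_real e * (asm_trace d r \<rho>' - asm_trace d r \<tau>')"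
    using assms(4) by (auto simp: decomposable_def)
  note asm = \<tau>[THEN unsteerable_assemblage] \<tau>'[THEN unsteerable_assemblage]
  show ?thesis
    unfolding decomposable_def
  proof (intro exI[of _ "asm_add r s \<tau> \<tau>'"] conjI allI impI)
    fix a x v assume ax: "a < r" "x < s"
    show "0 \<le> complex_of_real e *
        (qform d (asm_add r s \<rho> \<rho>' (a, x)) v - qform d (asm_add r s \<tau> \<tau>' (a, x)) v)"
      using add_nonneg_nonneg[OF dom[OF ax, of v] dom'[OF ax, of v]]
      by (simp add: asm_add_index[OF assms(1,2) ax] asm_add_index[OF asm ax] algebra_simps)
  qed (use \<tau> \<tau>' in \<open>auto simp: \<nu> \<nu>' unsteerable_add asm_trace_add[OF assms(1,2)] asm_trace_add[OF asm] algebra_simps\<close>)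
qed

subsection \<open>Existence of the minimum\<close>

lemma closed_Collect_complex_nonneg:
  fixes h :: "'a::topological_space \<Rightarrow> complex"
  assumes "continuous_on UNIV h" shows "closed {g. 0 \<le> h g}"
  unfolding less_eq_complex_def using assms
  by (auto intro!: closed_Collect_conj closed_Collect_le closed_Collect_eq continuous_intros)

text \<open>Tychonoff's theorem for a product of discs. The index type may be infinite, so
  coordinates without meaning need not be removed.\<close>

lemma compact_box:
  "compact (PiE UNIV (\<lambda>_. cball 0 C) :: ('i \<Rightarrow> complex) set)"
proof -
  have "compactin (product_topology (\<lambda>i. euclidean) UNIV) (PiE UNIV (\<lambda>_. cball 0 C) :: ('i \<Rightarrow> complex) set)"
    by (simp add: compactin_PiE)
  then show ?thesis
    by (simp add: euclidean_product_topology)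
qed

lemma decomposable_min:
  fixes e :: real
  assumes \<rho>: "assemblage d r s \<rho>" and e: "e = 1 \<or> e = -1" and ex: "decomposable e d r s \<rho> \<nu>\<^sub>0"
  shows "\<exists>\<nu>. decomposable e d r s \<rho> \<nu> \<and> (\<forall>\<nu>'. decomposable e d r s \<rho> \<nu>' \<longrightarrow> \<nu> \<le> \<nu>')"
proof -
  define S where "S = strategies r s"
  define m :: "((nat \<Rightarrow> nat) \<times> nat \<times> nat \<Rightarrow> complex) \<Rightarrow> (nat \<Rightarrow> nat) \<Rightarrow> complex mat"
    where "m g f = mat d d (\<lambda>(i, j). g (f, i, j))" for g f
  define obj where "obj g = e * (Re (asm_trace d r \<rho>) - (\<Sum>f\<in>S. \<Sum>i<d. Re (g (f, i, i))))"
    for g :: "(nat \<Rightarrow> nat) \<times> nat \<times> nat \<Rightarrow> complex"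
  define C where "C = 2 * (Re (asm_trace d r \<rho>) + \<nu>\<^sub>0)"
  define F where "F =
    (\<Inter>f\<in>S. \<Inter>v. {g. 0 \<le> qform d (m g f) v}) \<inter>
    (\<Inter>a\<in>{..<r}. \<Inter>x\<in>{..<s}. \<Inter>v.
      {g. 0 \<le> of_real e * (qform d (\<rho> (a, x)) v - (\<Sum>f\<in>{f \<in> S. f x = a}. qform d (m g f) v))})"
  have dims: "1 \<le> d" "1 \<le> r" "1 \<le> s"
    using \<rho> by (auto simp: assemblage_def)
  have cont: "continuous_on UNIV (\<lambda>g. qform d (m g f) v)" for f v
    unfolding qform_def m_def
    by (simp add: continuous_intros)
  have "closed F"
    unfolding F_def
    by (intro closed_Int closed_INT ballI closed_Collect_complex_nonneg continuous_intros cont)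
  then have compact: "compact (PiE UNIV (\<lambda>_. cball 0 C) \<inter> F)"
    using compact_box by (rule compact_Int_closed[rotated])
  have sound: "decomposable e d r s \<rho> (obj g)" if "g \<in> F" for g
  proof -
    have psd: "psd d (m g f)" if "f \<in> S" for f
      using \<open>g \<in> F\<close> that by (auto simp: F_def psd_iff_qform m_def)
    then have uns: "unsteerable d r s (hidden d r s (m g))"
      using dims by (intro unsteerable_hidden) (auto simp: S_def)
    have real: "Im (asm_trace d r \<rho>) = 0" "Im (asm_trace d r (hidden d r s (m g))) = 0"
      using asm_trace_nonneg[OF \<rho>] asm_trace_nonneg[OF unsteerable_assemblage[OF uns]]
      by (auto simp: less_eq_complex_def)
    have "asm_trace d r (hidden d r s (m g)) = (\<Sum>f\<in>S. \<Sum>i<d. g (f, i, i))"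
      unfolding asm_trace_hidden[OF dims(3)] S_def m_def by simp
    then have "of_real (obj g) = of_real e * (asm_trace d r \<rho> - asm_trace d r (hidden d r s (m g)))"
      using real by (simp add: complex_eq_iff obj_def)
    moreover have "0 \<le> of_real e * (qform d (\<rho> (a, x)) v - qform d (hidden d r s (m g) (a, x)) v)"
      if "a < r" "x < s" for a x v
      using \<open>g \<in> F\<close> that by (auto simp: F_def qform_msum S_def)
    ultimately show ?thesis
      unfolding decomposable_def using uns by blast
  qed
  have complete: "\<exists>g \<in> PiE UNIV (\<lambda>_. cball 0 C) \<inter> F. obj g = \<nu>"
    if dec: "decomposable e d r s \<rho> \<nu>" and le: "\<nu> \<le> \<nu>\<^sub>0" for \<nu>
  proof -
    obtain \<tau> where "unsteerable d r s \<tau>"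
      and \<tau>: "\<And>a x v. a < r \<Longrightarrow> x < s \<Longrightarrow>
        0 \<le> complex_of_real e * (qform d (\<rho> (a, x)) v - qform d (\<tau> (a, x)) v)"
        "of_real \<nu> = of_real e * (asm_trace d r \<rho> - asm_trace d r \<tau>)"
      using dec unfolding decomposable_def by blast
    then obtain \<xi> where psd: "\<And>f. f \<in> S \<Longrightarrow> psd d (\<xi> f)" and "\<tau> = hidden d r s \<xi>"
      unfolding unsteerable_def S_def by blast
    note dom = \<tau>(1)[unfolded this(2)] and \<nu> = \<tau>(2)[unfolded this(2)]
    \<comment> \<open>Coordinates that encode no entry are set to 0, which lies in every disc as
      soon as 0 \<le> C.\<close>
    define g where "g = (\<lambda>(f, i, j). if f \<in> S \<and> i < d \<and> j < d then \<xi> f $$ (i, j) else 0)"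
    have m: "m g f = \<xi> f" if "f \<in> S" for f
      using psd[OF that, THEN psd_carrier] that by (auto simp: m_def g_def intro!: eq_matI)
    have tr: "asm_trace d r (hidden d r s \<xi>) = (\<Sum>f\<in>S. mat_trace (\<xi> f))"
      unfolding asm_trace_hidden[OF dims(3)] S_def[symmetric]
      using psd psd_carrier by (intro sum.cong refl) (auto simp: mat_trace_def)
    have "Re (asm_trace d r (hidden d r s \<xi>)) = Re (asm_trace d r \<rho>) - e * \<nu>"
      using \<nu> e by (auto simp: complex_eq_iff)
    also have "\<dots> \<le> Re (asm_trace d r \<rho>) + \<nu>\<^sub>0"
      using e le decomposable_nonneg[OF dec] by auto
    finally have bound: "2 * Re (\<Sum>f\<in>S. mat_trace (\<xi> f)) \<le> C"
      by (simp add: tr C_def)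
    have entry: "cmod (\<xi> f $$ (i, j)) \<le> C" if "f \<in> S" "i < d" "j < d" for f i j
    proof -
      have "cmod (\<xi> f $$ (i, j)) \<le> 2 * Re (mat_trace (\<xi> f))"
        using psd that by (intro psd_entry_le_trace) auto
      also have "Re (mat_trace (\<xi> f)) \<le> (\<Sum>f\<in>S. Re (mat_trace (\<xi> f)))"
        using that psd psd_trace_nonneg
        by (intro member_le_sum) (auto simp: S_def less_eq_complex_def)
      finally show ?thesis
        using bound by simp
    qed
    have "0 \<le> C"
    proof -
      have "0 \<le> Re (asm_trace d r \<rho>)"
        using asm_trace_nonneg[OF \<rho>] by (simp add: less_eq_complex_def)
      then show ?thesis
        using decomposable_nonneg[OF ex] by (simp add: C_def)
    qed
    then have "g \<in> PiE UNIV (\<lambda>_. cball 0 C)"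
      using entry by (auto simp: g_def)
    moreover have "g \<in> F"
      using psd dom by (auto simp: F_def m psd_iff_qform qform_msum S_def[symmetric])
    moreover have "obj g = \<nu>"
    proof -
      have "(\<Sum>f\<in>S. \<Sum>i<d. Re (g (f, i, i))) = Re (asm_trace d r (hidden d r s \<xi>))"
        unfolding asm_trace_hidden[OF dims(3)] S_def[symmetric] by (simp add: g_def)
      then have "obj g = Re (complex_of_real \<nu>)"
        unfolding \<nu> by (simp add: obj_def)
      then show ?thesis
        by simp
    qed
    ultimately show ?thesis
      by blast
  qed
  have "continuous_on UNIV obj"
    unfolding obj_def[abs_def] by (intro continuous_intros) simp
  then have "continuous_on (PiE UNIV (\<lambda>_. cball 0 C) \<inter> F) obj"
    by (rule continuous_on_subset) simp
  moreover have "PiE UNIV (\<lambda>_. cball 0 C) \<inter> F \<noteq> {}"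
    using complete[OF ex] by blast
  ultimately have "\<exists>g\<in>PiE UNIV (\<lambda>_. cball 0 C) \<inter> F. \<forall>h\<in>PiE UNIV (\<lambda>_. cball 0 C) \<inter> F. obj g \<le> obj h"
    by (intro continuous_attains_inf compact)
  then obtain g where g: "g \<in> PiE UNIV (\<lambda>_. cball 0 C) \<inter> F"
    and min: "\<forall>h \<in> PiE UNIV (\<lambda>_. cball 0 C) \<inter> F. obj g \<le> obj h" ..
  have "obj g \<le> \<nu>'" if "decomposable e d r s \<rho> \<nu>'" for \<nu>'
  proof (cases "\<nu>' \<le> \<nu>\<^sub>0")
    case True
    then show ?thesis
      using complete[OF that True] min by auto
  next
    case False
    obtain h where "h \<in> PiE UNIV (\<lambda>_. cball 0 C) \<inter> F" "obj h = \<nu>\<^sub>0"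
      using complete[OF ex] by blast
    then show ?thesis
      using min[rule_format, of h] False by simp
  qed
  then show ?thesis
    using sound g by blast
qed

subsection \<open>Monotonicity and convexity\<close>

text \<open>A single hidden state with uniformly random answers; the factor \<open>r\<close> cancels
  the probability 1 / r. The family lies above \<rho>, and its multiples by 0 and 1 / r provide the
  zero family and a member of \<open>LHS\<close>.\<close>

lemma unsteerable_reduced:
  assumes "assemblage d r s \<rho>"
  shows "unsteerable d r s (restrict (\<lambda>_. reduced d r \<rho> 0) ({..<r} \<times> {..<s}))"
proof (rule unsteerableI[where \<Lambda> = "{()}" and p = "\<lambda>_ _ _. 1 / r" and \<xi> = "\<lambda>_. complex_of_real r \<cdot>\<^sub>m reduced d r \<rho> 0"])
  show "psd d (complex_of_real (real r) \<cdot>\<^sub>m reduced d r \<rho> 0)"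
    using assms by (intro psd_smult) (auto simp: reduced_def assemblage_def intro!: psd_msum)
  show "restrict (\<lambda>_. reduced d r \<rho> 0) ({..<r} \<times> {..<s}) (a, x) =
      msum d d (\<lambda>_. complex_of_real (1 / r) \<cdot>\<^sub>m (complex_of_real r \<cdot>\<^sub>m reduced d r \<rho> 0)) {()}"
    if "a < r" "x < s" for a x
    using that by (auto simp: reduced_def intro!: eq_matI)
qed (use assms in \<open>auto simp: assemblage_def prob_dist_def\<close>)

lemma decomposableI:
  assumes "assemblage d r s \<rho>" "unsteerable d r s \<tau>"
    and "\<And>a x v. a < r \<Longrightarrow> x < s \<Longrightarrow> 0 \<le> of_real e * (qform d (\<rho> (a, x)) v - qform d (\<tau> (a, x)) v)"
  shows "decomposable e d r s \<rho> (e * (Re (asm_trace d r \<rho>) - Re (asm_trace d r \<tau>)))"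
proof -
  have "Im (asm_trace d r \<rho>) = 0" "Im (asm_trace d r \<tau>) = 0"
    using asm_trace_nonneg assms unsteerable_assemblage by (fastforce simp: less_eq_complex_def)+
  then have "of_real (e * (Re (asm_trace d r \<rho>) - Re (asm_trace d r \<tau>))) =
      of_real e * (asm_trace d r \<rho> - asm_trace d r \<tau>)"
    by (simp add: complex_eq_iff)
  then show ?thesis
    using assms unfolding decomposable_def by blast
qed

text \<open>Below \<rho> there is always the zero family. Above it lies the family repeating the
  reduced operator, because each entry is one of the positive summands of that operator.\<close>

lemma decomposable_exists:
  assumes \<rho>: "assemblage d r s \<rho>" and e: "e = 1 \<or> e = -1"
  shows "\<exists>\<nu>. decomposable e d r s \<rho> \<nu>"
proof -
  let ?\<tau> = "restrict (\<lambda>_. reduced d r \<rho> 0) ({..<r} \<times> {..<s})"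
  have \<tau>: "unsteerable d r s ?\<tau>"
    using \<rho> by (rule unsteerable_reduced)
  have psd: "0 \<le> qform d (\<rho> (a, x)) v" if "a < r" "x < s" for a x v
    using \<rho> that by (auto simp: assemblage_def psd_iff_qform)
  show ?thesis
  proof (cases "e = 1")
    case True
    have "decomposable e d r s \<rho> (e * (Re (asm_trace d r \<rho>) - Re (asm_trace d r (asm_scale r s 0 ?\<tau>))))"
      using \<tau> psd True
      by (intro decomposableI \<rho> unsteerable_scale)
        (simp_all add: asm_scale_index[OF unsteerable_assemblage[OF \<tau>]])
    then show ?thesis ..
  next
    case False
    have "qform d (\<rho> (a, x)) v \<le> qform d (?\<tau> (a, x)) v" if ax: "a < r" "x < s" for a x v
    proof -
      have "qform d (\<rho> (a, x)) v \<le> (\<Sum>b<r. qform d (\<rho> (b, x)) v)"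
        using psd ax by (intro member_le_sum) auto
      also have "\<dots> = qform d (reduced d r \<rho> x) v"
        by (simp add: reduced_def qform_msum)
      also have "reduced d r \<rho> x = reduced d r \<rho> 0"
        using \<rho> ax(2) unfolding assemblage_def by (metis gr_zeroI less_nat_zero_code)
      finally show ?thesis
        using ax by simp
    qed
    then have "decomposable e d r s \<rho> (e * (Re (asm_trace d r \<rho>) - Re (asm_trace d r ?\<tau>)))"
      using False e by (intro decomposableI \<rho> \<tau>) (simp add: less_eq_complex_def)
    then show ?thesis ..
  qed
qed

text \<open>The choice \<tau> = \<rho> leaves no remainder, whatever the sign.\<close>

lemma decomposable_unsteerable:
  "unsteerable d r s \<rho> \<Longrightarrow> decomposable e d r s \<rho> 0"
  by (auto simp: decomposable_def intro!: exI[of _ \<rho>])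

lemma decomposable_locc:
  assumes M: "locc_1W d r s df rf sf M" and \<rho>: "assemblage d r s \<rho>" and dec: "decomposable e d r s \<rho> \<nu>"
  shows "\<exists>\<mu>. (\<forall>\<omega>\<in>outcomes M. decomposable e df rf sf (locc_branch r s df rf sf M \<omega> \<rho>) (\<mu> \<omega>)) \<and>
    (\<Sum>\<omega>\<in>outcomes M. \<mu> \<omega>) = \<nu>"
proof -
  obtain \<tau> where \<tau>: "unsteerable d r s \<tau>"
    and dom: "\<And>a x v. a < r \<Longrightarrow> x < s \<Longrightarrow> 0 \<le> complex_of_real e * (qform d (\<rho> (a, x)) v - qform d (\<tau> (a, x)) v)"
    and \<nu>: "of_real \<nu> = of_real e * (asm_trace d r \<rho> - asm_trace d r \<tau>)"
    using dec unfolding decomposable_def by blast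
  let ?B = "locc_branch r s df rf sf M"
  let ?\<mu> = "\<lambda>\<omega>. e * (Re (asm_trace df rf (?B \<omega> \<rho>)) - Re (asm_trace df rf (?B \<omega> \<tau>)))"
  have "decomposable e df rf sf (?B \<omega> \<rho>) (?\<mu> \<omega>)" if "\<omega> \<in> outcomes M" for \<omega>
    using that M \<rho> \<tau> unsteerable_assemblage[OF \<tau>] dom
    by (intro decomposableI assemblage_locc_branch unsteerable_locc_branch locc_branch_dominance) auto
  moreover have "(\<Sum>\<omega>\<in>outcomes M. ?\<mu> \<omega>) = e * (Re (\<Sum>\<omega>\<in>outcomes M. asm_trace df rf (?B \<omega> \<rho>)) -
      Re (\<Sum>\<omega>\<in>outcomes M. asm_trace df rf (?B \<omega> \<tau>)))"
    by (simp add: sum_subtractf flip: sum_distrib_left)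
  then have "(\<Sum>\<omega>\<in>outcomes M. ?\<mu> \<omega>) = Re (complex_of_real \<nu>)"
    unfolding \<nu> by (simp add: sum_asm_trace_locc_branch[OF M] \<rho> \<tau> unsteerable_assemblage)
  ultimately show ?thesis
    by (intro exI[of _ ?\<mu>]) simp
qed

lemma normalised_convex_combination:
  assumes "normalised d r s \<rho>" "normalised d r s \<rho>'" "0 \<le> \<mu>" "0 \<le> \<mu>'" "\<mu> + \<mu>' = 1"
  shows "normalised d r s (asm_add r s (asm_scale r s \<mu> \<rho>) (asm_scale r s \<mu>' \<rho>'))"
proof -
  have asm: "assemblage d r s (asm_scale r s \<mu> \<rho>)" "assemblage d r s (asm_scale r s \<mu>' \<rho>')"
    using assms by (auto simp: normalised_def intro: assemblage_scale)
  have "complex_of_real \<mu> + complex_of_real \<mu>' = 1"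
    using assms(5) by (metis of_real_1 of_real_add)
  then show ?thesis
    using assms asm by (simp add: normalised_def assemblage_add asm_trace_add[OF asm] asm_trace_scale)
qed

text \<open>The common core of both claims: the monotone axioms follow from being the least value of
  a decomposition, whatever \<open>e\<close> is. Each inequality exhibits a decomposition with the
  desired value and invokes minimality.\<close>

lemma convex_steering_monotone_least_decomposable:
  assumes dec: "\<And>d r s \<rho>. normalised d r s \<rho> \<Longrightarrow> decomposable e d r s \<rho> (S d r s \<rho>)"
    and least: "\<And>d r s \<rho> \<nu>. normalised d r s \<rho> \<Longrightarrow> decomposable e d r s \<rho> \<nu> \<Longrightarrow> S d r s \<rho> \<le> \<nu>"
  shows "convex_steering_monotone S"
  unfolding convex_steering_monotone_def steering_monotone_def
proof (intro conjI allI impI)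
  show nonneg: "0 \<le> S d r s \<rho>" if "normalised d r s \<rho>" for d r s \<rho>
    using dec[OF that] by (rule decomposable_nonneg)
  show "S d r s \<rho> = 0" if "LHS d r s \<rho>" for d r s \<rho>
    using that nonneg least[OF _ decomposable_unsteerable]
    by (auto simp: LHS_iff_unsteerable intro: antisym)
  show "S d r s (asm_add r s (asm_scale r s \<mu> \<rho>) (asm_scale r s (1 - \<mu>) \<rho>')) \<le> \<mu> * S d r s \<rho> + (1 - \<mu>) * S d r s \<rho>'"
    if "normalised d r s \<rho>" "normalised d r s \<rho>'" "0 \<le> \<mu>" "\<mu> \<le> 1" for d r s \<rho> \<rho>' \<mu>
    using that dec
    by (intro least normalised_convex_combination decomposable_add decomposable_scale assemblage_scale)
      (auto simp: normalised_def)
next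
  fix d r s df rf sf M \<rho>
  assume M: "locc_1W d r s df rf sf M" and norm: "normalised d r s \<rho>"
  let ?B = "locc_branch r s df rf sf M"
  let ?p = "branch_prob r s df rf sf M \<rho>"
  have \<rho>: "assemblage d r s \<rho>"
    using norm by (simp add: normalised_def)
  obtain \<mu> where \<mu>: "\<And>\<omega>. \<omega> \<in> outcomes M \<Longrightarrow> decomposable e df rf sf (?B \<omega> \<rho>) (\<mu> \<omega>)"
    and sum: "(\<Sum>\<omega>\<in>outcomes M. \<mu> \<omega>) = S d r s \<rho>"
    using decomposable_locc[OF M \<rho> dec[OF norm]] by blast
  \<comment> \<open>The branch is divided by its probability to reach trace 1, its decomposition is
    divided likewise, and the weight in the average undoes this.\<close>
  have step: "?p \<omega> * S df rf sf (asm_scale rf sf (1 / ?p \<omega>) (?B \<omega> \<rho>)) \<le> \<mu> \<omega>"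
    if \<omega>: "\<omega> \<in> outcomes M" and p: "?p \<omega> \<noteq> 0" for \<omega>
  proof -
    have B: "assemblage df rf sf (?B \<omega> \<rho>)"
      using M \<rho> \<omega> by (rule assemblage_locc_branch)
    have tr: "asm_trace df rf (?B \<omega> \<rho>) = of_real (?p \<omega>)" and pos: "0 < ?p \<omega>"
      using asm_trace_nonneg[OF B] p by (auto simp: branch_prob_def less_eq_complex_def complex_eq_iff)
    have "normalised df rf sf (asm_scale rf sf (1 / ?p \<omega>) (?B \<omega> \<rho>))"
      using pos by (simp add: normalised_def assemblage_scale[OF B] asm_trace_scale[OF B] tr)
    then have "S df rf sf (asm_scale rf sf (1 / ?p \<omega>) (?B \<omega> \<rho>)) \<le> 1 / ?p \<omega> * \<mu> \<omega>"
      using pos by (intro least decomposable_scale[OF B \<mu>[OF \<omega>]]) auto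
    then show ?thesis
      using pos by (simp add: field_simps)
  qed
  have "(\<Sum>\<omega> | \<omega> \<in> outcomes M \<and> ?p \<omega> \<noteq> 0. ?p \<omega> * S df rf sf (asm_scale rf sf (1 / ?p \<omega>) (?B \<omega> \<rho>)))
      \<le> (\<Sum>\<omega> | \<omega> \<in> outcomes M \<and> ?p \<omega> \<noteq> 0. \<mu> \<omega>)"
    using step by (intro sum_mono) auto
  \<comment> \<open>Branches of probability 0 may be restored, since their values are
    nonnegative.\<close>
  also have "\<dots> \<le> (\<Sum>\<omega>\<in>outcomes M. \<mu> \<omega>)"
    using M decomposable_nonneg[OF \<mu>] by (intro sum_mono2) (auto simp: locc_1W_def)
  finally show "(\<Sum>\<omega> | \<omega> \<in> outcomes M \<and> ?p \<omega> \<noteq> 0. ?p \<omega> * S df rf sf (asm_scale rf sf (1 / ?p \<omega>) (?B \<omega> \<rho>)))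
      \<le> S d r s \<rho>"
    by (simp add: sum)
qed

section \<open>Steerable weight and robustness as least decompositions\<close>

text \<open>At trace \<open>0\<close> the given normalised assemblage \<open>\<rho>\<close> serves as a junk value, since no rescaling of
  \<open>\<Delta> = 0\<close> is normalised.\<close>

lemma normalise_assemblage:
  assumes \<Delta>: "assemblage d r s \<Delta>" "asm_trace d r \<Delta> = of_real t" and \<rho>: "normalised d r s \<rho>"
  obtains \<sigma> where "normalised d r s \<sigma>" "asm_scale r s t \<sigma> = \<Delta>"
    "\<sigma> = \<rho> \<or> 0 < t \<and> \<sigma> = asm_scale r s (1 / t) \<Delta>"
proof -
  have t: "0 \<le> t"
    using asm_trace_nonneg[OF \<Delta>(1)] \<Delta>(2) by (simp add: less_eq_complex_def)
  define \<sigma> where "\<sigma> = (if t = 0 then \<rho> else asm_scale r s (1 / t) \<Delta>)"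
  have norm: "normalised d r s \<sigma>"
    using \<rho> \<Delta> t by (simp add: \<sigma>_def normalised_def assemblage_scale asm_trace_scale)
  then have \<sigma>: "assemblage d r s \<sigma>"
    by (simp add: normalised_def)
  moreover have "asm_scale r s t \<sigma> = \<Delta>"
  proof (rule assemblage_eqI)
    fix a x i j assume ax: "a < r" "x < s" and ij: "i < d" "j < d"
    show "asm_scale r s t \<sigma> (a, x) $$ (i, j) = \<Delta> (a, x) $$ (i, j)"
    proof (cases "t = 0")
      case True
      then have "\<Delta> (a, x) = 0\<^sub>m d d"
        using asm_trace_zero[OF \<Delta>(1) _ ax] \<Delta>(2) by simp
      then show ?thesis
        using True ij by (simp add: asm_scale_index(1)[OF \<sigma> ax])
    next
      case False
      then have "\<sigma> (a, x) $$ (i, j) = of_real (1 / t) * \<Delta> (a, x) $$ (i, j)"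
        using ij by (simp add: \<sigma>_def asm_scale_index(1)[OF \<Delta>(1) ax])
      then show ?thesis
        using False ij by (simp add: asm_scale_index(1)[OF \<sigma> ax])
    qed
  qed (use \<sigma> \<Delta> t in \<open>auto intro: assemblage_scale\<close>)
  ultimately show ?thesis
    using that[of \<sigma>] norm t by (auto simp: \<sigma>_def split: if_splits)
qed

text \<open>Repeating the reduced operator for each of the \<open>r\<close> answers gives trace
  \<open>r\<close>, hence the factor 1 / r. The result serves as a default where an unsteerable
  family has trace 0.\<close>

lemma LHS_exists:
  assumes "normalised d r s \<rho>" obtains \<sigma> where "LHS d r s \<sigma>"
proof -
  let ?\<tau> = "restrict (\<lambda>_. reduced d r \<rho> 0) ({..<r} \<times> {..<s})"
  have \<rho>: "assemblage d r s \<rho>"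
    using assms by (simp add: normalised_def)
  have \<tau>: "unsteerable d r s ?\<tau>"
    using \<rho> by (rule unsteerable_reduced)
  have rs: "0 < r" "0 < s"
    using \<rho> by (auto simp: assemblage_def)
  have "asm_trace d r ?\<tau> = of_real (real r) * asm_trace d r \<rho>"
    using rs by (simp add: asm_trace_eq reduced_def sum_distrib_left)
  then have "asm_trace d r ?\<tau> = of_real (real r)"
    using assms by (simp add: normalised_def)
  then have "LHS d r s (asm_scale r s (1 / r) ?\<tau>)"
    using \<tau> rs by (simp add: LHS_iff_unsteerable unsteerable_scale normalised_def assemblage_scale
        unsteerable_assemblage asm_trace_scale[OF unsteerable_assemblage[OF \<tau>]])
  then show ?thesis
    using that by blast
qed

text \<open>At trace 0 the default must be unsteerable itself, so a member of \<open>LHS\<close>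
  takes the place of \<rho> in \<open>normalise_assemblage\<close>; the last conclusion of that
  lemma separates the two cases.\<close>

lemma normalise_unsteerable:
  assumes \<tau>: "unsteerable d r s \<tau>" "asm_trace d r \<tau> = of_real t" and \<rho>: "normalised d r s \<rho>"
  obtains \<sigma> where "LHS d r s \<sigma>" "asm_scale r s t \<sigma> = \<tau>"
proof -
  obtain \<sigma>\<^sub>0 where \<sigma>\<^sub>0: "LHS d r s \<sigma>\<^sub>0"
    using LHS_exists[OF \<rho>] by blast
  then have "normalised d r s \<sigma>\<^sub>0"
    by (simp add: LHS_def)
  then obtain \<sigma> where \<sigma>: "normalised d r s \<sigma>" "asm_scale r s t \<sigma> = \<tau>"
      "\<sigma> = \<sigma>\<^sub>0 \<or> 0 < t \<and> \<sigma> = asm_scale r s (1 / t) \<tau>"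
    using normalise_assemblage[OF unsteerable_assemblage[OF \<tau>(1)] \<tau>(2)] by metis
  have "LHS d r s \<sigma>"
    using \<sigma>(3)
  proof
    assume "0 < t \<and> \<sigma> = asm_scale r s (1 / t) \<tau>"
    then have "unsteerable d r s \<sigma>"
      using unsteerable_scale[OF \<tau>(1), of "1 / t"] by simp
    then show ?thesis
      using \<sigma>(1) by (simp add: LHS_iff_unsteerable)
  qed (use \<sigma>\<^sub>0 in simp)
  then show ?thesis
    using that \<sigma>(2) by blast
qed

text \<open>Dominance makes the signed difference positive, and no-signaling passes to differences.
  Hence the remainder of a decomposition is an assemblage without any further condition on
  \<tau>.\<close>

lemma dominance_difference:
  fixes e :: real
  assumes \<rho>: "assemblage d r s \<rho>" and \<tau>: "assemblage d r s \<tau>"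
    and dom: "\<And>a x v. a < r \<Longrightarrow> x < s \<Longrightarrow> 0 \<le> of_real e * (qform d (\<rho> (a, x)) v - qform d (\<tau> (a, x)) v)"
  obtains \<Delta> where "assemblage d r s \<Delta>"
    "asm_trace d r \<Delta> = of_real e * (asm_trace d r \<rho> - asm_trace d r \<tau>)"
    "\<And>a x i j. a < r \<Longrightarrow> x < s \<Longrightarrow> i < d \<Longrightarrow> j < d \<Longrightarrow>
      \<Delta> (a, x) $$ (i, j) = of_real e * (\<rho> (a, x) $$ (i, j) - \<tau> (a, x) $$ (i, j))"
proof -
  define \<Delta> where "\<Delta> = restrict (\<lambda>p. mat d d (\<lambda>ij. of_real e * (\<rho> p $$ ij - \<tau> p $$ ij))) ({..<r} \<times> {..<s})"
  have index: "\<Delta> (a, x) $$ (i, j) = of_real e * (\<rho> (a, x) $$ (i, j) - \<tau> (a, x) $$ (i, j))"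
    if "a < r" "x < s" "i < d" "j < d" for a x i j
    using that by (simp add: \<Delta>_def)
  have dims: "1 \<le> d" "1 \<le> r" "1 \<le> s"
    using \<rho> by (auto simp: assemblage_def)
  have "psd d (\<Delta> (a, x))" if ax: "a < r" "x < s" for a x
  proof -
    have "qform d (\<Delta> (a, x)) v = of_real e * (qform d (\<rho> (a, x)) v - qform d (\<tau> (a, x)) v)" for v
      unfolding qform_def
      by (simp add: index ax sum_distrib_left sum_subtractf[symmetric] algebra_simps)
    then show ?thesis
      using dom[OF ax] ax by (simp add: psd_iff_qform \<Delta>_def)
  qed
  moreover have "(\<Sum>a<r. \<Delta> (a, x) $$ (i, j)) = (\<Sum>a<r. \<Delta> (a, y) $$ (i, j))"
    if xy: "x < s" "y < s" "i < d" "j < d" for x y i j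
  proof -
    have "(\<Sum>a<r. \<Delta> (a, z) $$ (i, j)) =
        of_real e * ((\<Sum>a<r. \<rho> (a, z) $$ (i, j)) - (\<Sum>a<r. \<tau> (a, z) $$ (i, j)))" if "z < s" for z
      using that xy by (simp add: index sum_subtractf flip: sum_distrib_left)
    then show ?thesis
      using assemblage_no_signaling[OF \<rho> xy] assemblage_no_signaling[OF \<tau> xy] xy by simp
  qed
  moreover have "\<Delta> \<in> extensional ({..<r} \<times> {..<s})"
    by (simp add: \<Delta>_def)
  ultimately have asm: "assemblage d r s \<Delta>"
    using dims unfolding assemblage_iff_entries by blast
  have tr: "asm_trace d r \<Delta> = of_real e * (asm_trace d r \<rho> - asm_trace d r \<tau>)"
    using dims by (simp add: asm_trace_eq index sum_subtractf flip: sum_distrib_left)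
  show ?thesis
    by (rule that[OF asm tr]) (rule index)
qed

text \<open>The correspondence is \<tau> = (1 - \<nu>) \<sigma> and \<rho> - \<tau> = \<nu> \<rho>'.
  The bound \<nu> \<le> 1 keeps the coefficient of \<sigma> nonnegative, so that \<tau> stays in the
  cone.\<close>

lemma weight_feasible_iff_decomposable:
  assumes norm: "normalised d r s \<rho>" and \<nu>: "0 \<le> \<nu>" "\<nu> \<le> 1"
  shows "(\<exists>\<rho>' \<sigma>. normalised d r s \<rho>' \<and> LHS d r s \<sigma> \<and>
      \<rho> = asm_add r s (asm_scale r s \<nu> \<rho>') (asm_scale r s (1 - \<nu>) \<sigma>)) \<longleftrightarrow> decomposable 1 d r s \<rho> \<nu>"
proof (intro iffI; (elim exE conjE)?)
  fix \<rho>' \<sigma>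
  assume \<rho>': "normalised d r s \<rho>'" and \<sigma>: "LHS d r s \<sigma>"
    and \<rho>: "\<rho> = asm_add r s (asm_scale r s \<nu> \<rho>') (asm_scale r s (1 - \<nu>) \<sigma>)"
  let ?\<tau> = "asm_scale r s (1 - \<nu>) \<sigma>"
  have \<tau>: "unsteerable d r s ?\<tau>"
    using \<sigma> \<nu> by (simp add: LHS_iff_unsteerable unsteerable_scale)
  have asm: "assemblage d r s \<rho>'" "assemblage d r s \<sigma>"
    using \<rho>' \<sigma> by (auto simp: normalised_def LHS_def)
  note scaled = assemblage_scale[OF asm(1) \<nu>(1)] unsteerable_assemblage[OF \<tau>]
  show "decomposable 1 d r s \<rho> \<nu>"
    unfolding decomposable_def
  proof (intro exI[of _ ?\<tau>] conjI allI impI \<tau>)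
    fix a x v assume ax: "a < r" "x < s"
    have "0 \<le> complex_of_real \<nu> * qform d (\<rho>' (a, x)) v"
      using asm(1) ax \<nu>(1) by (intro mult_nonneg_nonneg) (auto simp: assemblage_def psd_iff_qform less_eq_complex_def)
    then show "0 \<le> complex_of_real 1 * (qform d (\<rho> (a, x)) v - qform d (?\<tau> (a, x)) v)"
      by (simp add: \<rho> asm_add_index[OF scaled ax] asm_scale_index[OF asm(1) ax])
  next
    show "of_real \<nu> = of_real 1 * (asm_trace d r \<rho> - asm_trace d r ?\<tau>)"
      using \<rho>' by (simp add: \<rho> asm_trace_add[OF scaled] asm_trace_scale[OF asm(1)] normalised_def)
  qed
next
  assume "decomposable 1 d r s \<rho> \<nu>"
  then obtain \<tau> where \<tau>: "unsteerable d r s \<tau>"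
    and dom: "\<And>a x v. a < r \<Longrightarrow> x < s \<Longrightarrow> 0 \<le> complex_of_real 1 * (qform d (\<rho> (a, x)) v - qform d (\<tau> (a, x)) v)"
    and \<nu>_eq: "of_real \<nu> = of_real 1 * (asm_trace d r \<rho> - asm_trace d r \<tau>)"
    unfolding decomposable_def by blast
  have \<rho>: "assemblage d r s \<rho>" and tr: "asm_trace d r \<rho> = 1"
    using norm by (auto simp: normalised_def)
  note \<tau>' = unsteerable_assemblage[OF \<tau>]
  obtain \<Delta> where \<Delta>: "assemblage d r s \<Delta>" "asm_trace d r \<Delta> = of_real \<nu>"
    and \<Delta>_index: "\<And>a x i j. a < r \<Longrightarrow> x < s \<Longrightarrow> i < d \<Longrightarrow> j < d \<Longrightarrow>
      \<Delta> (a, x) $$ (i, j) = of_real 1 * (\<rho> (a, x) $$ (i, j) - \<tau> (a, x) $$ (i, j))"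
    using dominance_difference[OF \<rho> \<tau>' dom] \<nu>_eq by metis
  obtain \<rho>' where \<rho>': "normalised d r s \<rho>'" "asm_scale r s \<nu> \<rho>' = \<Delta>"
    using normalise_assemblage[OF \<Delta> norm] by blast
  have "asm_trace d r \<tau> = of_real (1 - \<nu>)"
    using \<nu>_eq tr by simp
  then obtain \<sigma> where \<sigma>: "LHS d r s \<sigma>" "asm_scale r s (1 - \<nu>) \<sigma> = \<tau>"
    using normalise_unsteerable[OF \<tau> _ norm] by blast
  have "\<rho> = asm_add r s \<Delta> \<tau>"
    using \<rho> \<Delta>(1) \<tau>' by (intro assemblage_eqI[where d = d]) (auto simp: assemblage_add asm_add_index(1) \<Delta>_index)
  then show "\<exists>\<rho>' \<sigma>. normalised d r s \<rho>' \<and> LHS d r s \<sigma> \<and>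
      \<rho> = asm_add r s (asm_scale r s \<nu> \<rho>') (asm_scale r s (1 - \<nu>) \<sigma>)"
    using \<rho>' \<sigma> by blast
qed

text \<open>With \<sigma> the unsteerable mixture, the correspondence is \<tau> = (1 + \<nu>)
  \<sigma> and \<tau> - \<rho> = \<nu> \<rho>'. The coefficient of \<sigma> is positive for every
  \<nu> \<ge> 0, so no upper bound is imposed.\<close>

lemma robustness_feasible_iff_decomposable:
  assumes norm: "normalised d r s \<rho>" and \<nu>: "0 \<le> \<nu>"
  shows "(\<exists>\<rho>'. normalised d r s \<rho>' \<and>
      LHS d r s (asm_add r s (asm_scale r s (1 / (1 + \<nu>)) \<rho>) (asm_scale r s (\<nu> / (1 + \<nu>)) \<rho>'))) \<longleftrightarrow>
    decomposable (-1) d r s \<rho> \<nu>"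
proof (intro iffI; (elim exE conjE)?)
  have \<rho>: "assemblage d r s \<rho>" and tr: "asm_trace d r \<rho> = 1"
    using norm by (auto simp: normalised_def)
  have weights: "0 \<le> 1 / (1 + \<nu>)" "0 \<le> \<nu> / (1 + \<nu>)" "1 / (1 + \<nu>) + \<nu> / (1 + \<nu>) = 1"
    "1 + \<nu> \<noteq> 0"
    using \<nu> by (auto simp: add_divide_distrib[symmetric])
  have cancel: "of_real (1 + \<nu>) * (of_real (1 / (1 + \<nu>)) * z + of_real (\<nu> / (1 + \<nu>)) * z') = z + of_real \<nu> * z'"
    for z z' :: complex
  proof -
    have "(1 + \<nu>) * (1 / (1 + \<nu>)) = 1" "(1 + \<nu>) * (\<nu> / (1 + \<nu>)) = \<nu>"
      using weights(4) by simp_all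
    then show ?thesis
      by (simp only: distrib_left mult.assoc[symmetric] of_real_mult[symmetric]) simp
  qed
  {
    fix \<rho>'
    let ?\<sigma> = "asm_add r s (asm_scale r s (1 / (1 + \<nu>)) \<rho>) (asm_scale r s (\<nu> / (1 + \<nu>)) \<rho>')"
    assume \<rho>': "normalised d r s \<rho>'" and \<sigma>: "LHS d r s ?\<sigma>"
    let ?\<tau> = "asm_scale r s (1 + \<nu>) ?\<sigma>"
    have \<tau>: "unsteerable d r s ?\<tau>"
      using \<sigma> \<nu> by (simp add: LHS_iff_unsteerable unsteerable_scale)
    have asm: "assemblage d r s \<rho>'" "assemblage d r s ?\<sigma>"
      using \<rho>' \<sigma> by (auto simp: normalised_def LHS_def)
    note scaled = assemblage_scale[OF \<rho> weights(1)] assemblage_scale[OF asm(1) weights(2)]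
    show "decomposable (-1) d r s \<rho> \<nu>"
      unfolding decomposable_def
    proof (intro exI[of _ ?\<tau>] conjI allI impI \<tau>)
      fix a x v assume ax: "a < r" "x < s"
      have "qform d (?\<tau> (a, x)) v = qform d (\<rho> (a, x)) v + of_real \<nu> * qform d (\<rho>' (a, x)) v"
        unfolding asm_scale_index(2)[OF asm(2) ax] asm_add_index(2)[OF scaled ax]
          asm_scale_index(2)[OF \<rho> ax] asm_scale_index(2)[OF asm(1) ax] by (rule cancel)
      moreover have "0 \<le> complex_of_real \<nu> * qform d (\<rho>' (a, x)) v"
        using asm(1) ax \<nu> by (intro mult_nonneg_nonneg) (auto simp: assemblage_def psd_iff_qform less_eq_complex_def)
      ultimately show "0 \<le> complex_of_real (-1) * (qform d (\<rho> (a, x)) v - qform d (?\<tau> (a, x)) v)"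
        by simp
    next
      show "of_real \<nu> = of_real (-1) * (asm_trace d r \<rho> - asm_trace d r ?\<tau>)"
        using \<sigma> tr by (simp add: asm_trace_scale[OF asm(2)] LHS_def normalised_def)
    qed
  }
  assume "decomposable (-1) d r s \<rho> \<nu>"
  then obtain \<tau> where \<tau>: "unsteerable d r s \<tau>"
    and dom: "\<And>a x v. a < r \<Longrightarrow> x < s \<Longrightarrow> 0 \<le> complex_of_real (-1) * (qform d (\<rho> (a, x)) v - qform d (\<tau> (a, x)) v)"
    and \<nu>_eq: "of_real \<nu> = of_real (-1) * (asm_trace d r \<rho> - asm_trace d r \<tau>)"
    unfolding decomposable_def by blast
  note \<tau>' = unsteerable_assemblage[OF \<tau>]
  obtain \<Delta> where \<Delta>: "assemblage d r s \<Delta>" "asm_trace d r \<Delta> = of_real \<nu>"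
    and \<Delta>_index: "\<And>a x i j. a < r \<Longrightarrow> x < s \<Longrightarrow> i < d \<Longrightarrow> j < d \<Longrightarrow>
      \<Delta> (a, x) $$ (i, j) = of_real (-1) * (\<rho> (a, x) $$ (i, j) - \<tau> (a, x) $$ (i, j))"
    using dominance_difference[OF \<rho> \<tau>' dom] \<nu>_eq by metis
  obtain \<rho>' where \<rho>': "normalised d r s \<rho>'" "asm_scale r s \<nu> \<rho>' = \<Delta>"
    using normalise_assemblage[OF \<Delta> norm] by blast
  have asm: "assemblage d r s \<rho>'"
    using \<rho>' by (simp add: normalised_def)
  have tr_\<tau>: "asm_trace d r \<tau> = of_real (1 + \<nu>)"
    using \<nu>_eq tr by (simp add: algebra_simps)
  obtain \<sigma> where \<sigma>: "LHS d r s \<sigma>" "asm_scale r s (1 + \<nu>) \<sigma> = \<tau>"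
    using normalise_unsteerable[OF \<tau> tr_\<tau> norm] by blast
  have \<sigma>': "assemblage d r s \<sigma>"
    using \<sigma> by (simp add: LHS_def normalised_def)
  note scaled = assemblage_scale[OF \<rho> weights(1)] assemblage_scale[OF asm weights(2)]
  have "asm_add r s (asm_scale r s (1 / (1 + \<nu>)) \<rho>) (asm_scale r s (\<nu> / (1 + \<nu>)) \<rho>') = \<sigma>" (is "?L = _")
  proof (rule assemblage_eqI)
    fix a x i j assume ax: "a < r" "x < s" and ij: "i < d" "j < d"
    have "of_real \<nu> * \<rho>' (a, x) $$ (i, j) = \<tau> (a, x) $$ (i, j) - \<rho> (a, x) $$ (i, j)"
      using \<Delta>_index[OF ax ij] unfolding \<rho>'(2)[symmetric] asm_scale_index(1)[OF asm ax ij] by simp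
    then have "of_real (1 + \<nu>) * ?L (a, x) $$ (i, j) = \<tau> (a, x) $$ (i, j)"
      unfolding asm_add_index(1)[OF scaled ax ij] asm_scale_index(1)[OF \<rho> ax ij]
        asm_scale_index(1)[OF asm ax ij] cancel by simp
    also have "\<dots> = of_real (1 + \<nu>) * \<sigma> (a, x) $$ (i, j)"
      unfolding \<sigma>(2)[symmetric] by (rule asm_scale_index(1)[OF \<sigma>' ax ij])
    finally show "?L (a, x) $$ (i, j) = \<sigma> (a, x) $$ (i, j)"
      using weights(4) by (simp only: mult_cancel_left of_real_eq_0_iff simp_thms)
  qed (intro assemblage_add scaled \<sigma>')+
  then show "\<exists>\<rho>'. normalised d r s \<rho>' \<and>
      LHS d r s (asm_add r s (asm_scale r s (1 / (1 + \<nu>)) \<rho>) (asm_scale r s (\<nu> / (1 + \<nu>)) \<rho>'))"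
    using \<rho>' \<sigma> by metis
qed

section \<open>Identification of the two minima\<close>

text \<open>The trace of \<tau> is nonnegative. This places the least value in the range where
  feasibility for the weight and decomposability agree.\<close>

lemma decomposable_le_one:
  assumes "normalised d r s \<rho>" "decomposable 1 d r s \<rho> \<nu>" shows "\<nu> \<le> 1"
proof -
  obtain \<tau> where \<tau>: "unsteerable d r s \<tau>" "of_real \<nu> = asm_trace d r \<rho> - asm_trace d r \<tau>"
    using assms(2) unfolding decomposable_def by auto
  have "0 \<le> asm_trace d r \<tau>" "of_real \<nu> = 1 - asm_trace d r \<tau>"
    using assms(1) \<tau> asm_trace_nonneg[OF unsteerable_assemblage[OF \<tau>(1)]] by (simp_all add: normalised_def)
  then show ?thesis
    by (simp add: complex_eq_iff less_eq_complex_def)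
qed

lemma steerable_weight_least:
  assumes norm: "normalised d r s \<rho>"
  shows "decomposable 1 d r s \<rho> (steerable_weight d r s \<rho>)"
    and "decomposable 1 d r s \<rho> \<nu> \<Longrightarrow> steerable_weight d r s \<rho> \<le> \<nu>"
proof -
  have \<rho>: "assemblage d r s \<rho>"
    using norm by (simp add: normalised_def)
  obtain \<mu> where \<mu>: "decomposable 1 d r s \<rho> \<mu>" and least: "\<And>\<nu>. decomposable 1 d r s \<rho> \<nu> \<Longrightarrow> \<mu> \<le> \<nu>"
    using decomposable_exists[OF \<rho>, of 1] decomposable_min[OF \<rho>, of 1] by blast
  have \<mu>_bounds: "0 \<le> \<mu>" "\<mu> \<le> 1"
    using \<mu> norm by (auto intro: decomposable_nonneg decomposable_le_one)
  have "steerable_weight d r s \<rho> = \<mu>"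
    unfolding steerable_weight_def
  proof (rule Least_equality)
    show "0 \<le> \<mu> \<and> (\<exists>\<rho>' \<sigma>. normalised d r s \<rho>' \<and> LHS d r s \<sigma> \<and>
        \<rho> = asm_add r s (asm_scale r s \<mu> \<rho>') (asm_scale r s (1 - \<mu>) \<sigma>))"
      using \<mu> \<mu>_bounds weight_feasible_iff_decomposable[OF norm \<mu>_bounds] by blast
  next
    fix \<nu> assume "0 \<le> \<nu> \<and> (\<exists>\<rho>' \<sigma>. normalised d r s \<rho>' \<and> LHS d r s \<sigma> \<and>
        \<rho> = asm_add r s (asm_scale r s \<nu> \<rho>') (asm_scale r s (1 - \<nu>) \<sigma>))"
    \<comment> \<open>For \<nu> > 1 the coefficient 1 - \<nu> is negative and feasibility is not
      translated; such \<nu> exceed \<mu> \<le> 1 anyway.\<close>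
    then have "\<nu> \<le> 1 \<Longrightarrow> decomposable 1 d r s \<rho> \<nu>"
      using weight_feasible_iff_decomposable[OF norm, of \<nu>] by blast
    then show "\<mu> \<le> \<nu>"
      using least[of \<nu>] \<mu>_bounds by linarith
  qed
  then show "decomposable 1 d r s \<rho> (steerable_weight d r s \<rho>)"
    and "decomposable 1 d r s \<rho> \<nu> \<Longrightarrow> steerable_weight d r s \<rho> \<le> \<nu>"
    using \<mu> least by auto
qed

lemma steering_robustness_least:
  assumes norm: "normalised d r s \<rho>"
  shows "decomposable (-1) d r s \<rho> (steering_robustness d r s \<rho>)"
    and "decomposable (-1) d r s \<rho> \<nu> \<Longrightarrow> steering_robustness d r s \<rho> \<le> \<nu>"
proof -
  have \<rho>: "assemblage d r s \<rho>"
    using norm by (simp add: normalised_def)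
  obtain \<mu> where \<mu>: "decomposable (-1) d r s \<rho> \<mu>" and least: "\<And>\<nu>. decomposable (-1) d r s \<rho> \<nu> \<Longrightarrow> \<mu> \<le> \<nu>"
    using decomposable_exists[OF \<rho>, of "-1"] decomposable_min[OF \<rho>, of "-1"] by blast
  have "steering_robustness d r s \<rho> = \<mu>"
    unfolding steering_robustness_def
  proof (rule Least_equality)
    show "0 \<le> \<mu> \<and> (\<exists>\<rho>'. normalised d r s \<rho>' \<and>
        LHS d r s (asm_add r s (asm_scale r s (1 / (1 + \<mu>)) \<rho>) (asm_scale r s (\<mu> / (1 + \<mu>)) \<rho>')))"
      using \<mu> decomposable_nonneg[OF \<mu>] robustness_feasible_iff_decomposable[OF norm] by blast
  next
    fix \<nu> assume "0 \<le> \<nu> \<and> (\<exists>\<rho>'. normalised d r s \<rho>' \<and>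
        LHS d r s (asm_add r s (asm_scale r s (1 / (1 + \<nu>)) \<rho>) (asm_scale r s (\<nu> / (1 + \<nu>)) \<rho>')))"
    then show "\<mu> \<le> \<nu>"
      using robustness_feasible_iff_decomposable[OF norm, of \<nu>] least by blast
  qed
  then show "decomposable (-1) d r s \<rho> (steering_robustness d r s \<rho>)"
    and "decomposable (-1) d r s \<rho> \<nu> \<Longrightarrow> steering_robustness d r s \<rho> \<le> \<nu>"
    using \<mu> least by auto
qed

theorem theorem3:
  shows "convex_steering_monotone steerable_weight \<and> convex_steering_monotone steering_robustness"
  using convex_steering_monotone_least_decomposable[of 1 steerable_weight]
    convex_steering_monotone_least_decomposable[of "-1" steering_robustness]
    steerable_weight_least steering_robustness_least
  by blast

end
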